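(* Let $F$ be a field of characteristic not equal to $2$, let $\alpha$ and $\beta$ be partitions of $n$, and suppose that $\beta$ is a one-box-shift of $\alpha$. Then $\dim_F\operatorname{Hom}_{F\Sigma_n}(S^\alpha,S^\beta)\leq 1$.
   Context: $S^\alpha$, $S^\beta$ are the Specht modules of James over $F$. A partition $\beta$ of $n$ is a one-box-shift of a partition $\alpha$ of $n$ if the Young diagram $[\beta]$ can be obtained from $[\alpha]$ by moving a single node; equivalently, $\alpha\ne\beta$ and there is a partition $\lambda$ of $n+1$ such that $\alpha$ and $\beta$ can each be obtained by removing a node from the Young diagram of $\lambda$. *)

theory Defs
  imports Complex_Main "HOL-Library.Function_Algebras" "HOL-Combinatorics.Permutations"
begin

text \<open>A partition is the list of its nonzero parts in weakly decreasing order, so distinct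
  lists are distinct partitions.\<close>

definition partition_of :: "nat \<Rightarrow> nat list \<Rightarrow> bool" where
  "partition_of n \<mu> \<longleftrightarrow> sorted_wrt (\<ge>) \<mu> \<and> 0 \<notin> set \<mu> \<and> sum_list \<mu> = n"

definition young_diagram :: "nat list \<Rightarrow> (nat \<times> nat) set" where
  "young_diagram \<mu> = {(i, j). i < length \<mu> \<and> j < \<mu> ! i}"

definition one_box_shift :: "nat list \<Rightarrow> nat list \<Rightarrow> bool" where
  "one_box_shift \<alpha> \<beta> \<longleftrightarrow>
     (\<exists>x\<in>young_diagram \<alpha>. \<exists>y. y \<notin> young_diagram \<alpha> \<and>
        young_diagram \<beta> = insert y (young_diagram \<alpha> - {x}))"

text \<open>A tableau is extended by 0 outside the diagram.  Permutations of
  \<open>{1..n}\<close> fix 0, so \<open>\<pi> \<circ> t\<close> is again a tableau of the same shape.\<close>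

type_synonym tableau = "nat \<times> nat \<Rightarrow> nat"

definition tableaux :: "nat list \<Rightarrow> tableau set" where
  "tableaux \<mu> = {t. bij_betw t (young_diagram \<mu>) {1..sum_list \<mu>} \<and>
                      (\<forall>x. x \<notin> young_diagram \<mu> \<longrightarrow> t x = 0)}"

definition row_stabilizer :: "nat list \<Rightarrow> tableau \<Rightarrow> (nat \<Rightarrow> nat) set" where
  "row_stabilizer \<mu> t = {\<pi>. \<pi> permutes {1..sum_list \<mu>} \<and>
     (\<forall>(i, j)\<in>young_diagram \<mu>. \<exists>k. (i, k) \<in> young_diagram \<mu> \<and> \<pi> (t (i, j)) = t (i, k))}"

definition column_stabilizer :: "nat list \<Rightarrow> tableau \<Rightarrow> (nat \<Rightarrow> nat) set" where
  "column_stabilizer \<mu> t = {\<pi>. \<pi> permutes {1..sum_list \<mu>} \<and>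
     (\<forall>(i, j)\<in>young_diagram \<mu>. \<exists>k. (k, j) \<in> young_diagram \<mu> \<and> \<pi> (t (i, j)) = t (k, j))}"

definition tabloid :: "nat list \<Rightarrow> tableau \<Rightarrow> tableau set" where
  "tabloid \<mu> t = (\<lambda>\<pi>. \<pi> \<circ> t) ` row_stabilizer \<mu> t"

text \<open>An element of the permutation module on the tabloids of shape \<open>\<mu>\<close> is given by its
  coefficient function, which vanishes off the set of those tabloids.\<close>

type_synonym 'a tabloid_vector = "tableau set \<Rightarrow> 'a"

definition fun_scale :: "'a::field \<Rightarrow> ('b \<Rightarrow> 'a) \<Rightarrow> 'b \<Rightarrow> 'a" where
  "fun_scale c v = (\<lambda>x. c * v x)"

definition map_scale :: "'a::field \<Rightarrow> ('c \<Rightarrow> 'b \<Rightarrow> 'a) \<Rightarrow> 'c \<Rightarrow> 'b \<Rightarrow> 'a" where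
  "map_scale c h = (\<lambda>v. fun_scale c (h v))"

global_interpretation fun_space: vector_space fun_scale
  by unfold_locales (auto simp: fun_scale_def fun_eq_iff algebra_simps)

global_interpretation map_space: vector_space map_scale
  by unfold_locales (auto simp: map_scale_def fun_scale_def fun_eq_iff algebra_simps)

definition basis_vector :: "tableau set \<Rightarrow> 'a::field tabloid_vector" where
  "basis_vector T = (\<lambda>X. if X = T then 1 else 0)"

definition permutation_module :: "nat list \<Rightarrow> 'a::field tabloid_vector set" where
  "permutation_module \<mu> = fun_space.span (basis_vector ` tabloid \<mu> ` tableaux \<mu>)"

text \<open>The action permuting the tabloids; on coefficient functions this is precomposition with
  the inverse (see \<open>act_basis_vector\<close>).\<close>

definition act :: "(nat \<Rightarrow> nat) \<Rightarrow> 'a::field tabloid_vector \<Rightarrow> 'a tabloid_vector" where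
  "act \<pi> v = (\<lambda>T. v ((\<lambda>t. inv \<pi> \<circ> t) ` T))"

definition polytabloid :: "nat list \<Rightarrow> tableau \<Rightarrow> 'a::field tabloid_vector" where
  "polytabloid \<mu> t = (\<Sum>\<pi>\<in>column_stabilizer \<mu> t.
     fun_scale (of_int (sign \<pi>)) (basis_vector (tabloid \<mu> (\<pi> \<circ> t))))"

definition specht_module :: "nat list \<Rightarrow> 'a::field tabloid_vector set" where
  "specht_module \<mu> = fun_space.span (polytabloid \<mu> ` tableaux \<mu>)"

text \<open>The homomorphisms \<open>S\<^sup>\<alpha> \<rightarrow> S\<^sup>\<beta>\<close> over the group algebra: the \<open>F\<close>-linear maps commuting
  with the symmetric group on \<open>{1..n}\<close>.  A map on \<open>S\<^sup>\<alpha>\<close> is represented by its extension by 0,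
  so that distinct elements of this set are distinct homomorphisms.\<close>

definition specht_hom ::
  "nat \<Rightarrow> nat list \<Rightarrow> nat list \<Rightarrow> ('a::field tabloid_vector \<Rightarrow> 'a tabloid_vector) set" where
  "specht_hom n \<alpha> \<beta> = {h.
     (\<forall>v\<in>specht_module \<alpha>. h v \<in> specht_module \<beta>) \<and>
     (\<forall>v\<in>specht_module \<alpha>. \<forall>w\<in>specht_module \<alpha>. h (v + w) = h v + h w) \<and>
     (\<forall>c. \<forall>v\<in>specht_module \<alpha>. h (fun_scale c v) = fun_scale c (h v)) \<and>
     (\<forall>\<pi>. \<pi> permutes {1..n} \<longrightarrow> (\<forall>v\<in>specht_module \<alpha>. h (act \<pi> v) = act \<pi> (h v))) \<and>
     (\<forall>v. v \<notin> specht_module \<alpha> \<longrightarrow> h v = 0)}"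

lemma comp_mem_tableaux:
  assumes "t \<in> tableaux \<mu>" "\<pi> permutes {1..sum_list \<mu>}"
  shows "\<pi> \<circ> t \<in> tableaux \<mu>"
proof -
  have "\<pi> 0 = 0"
    using assms(2) by (simp add: permutes_def)
  moreover have "bij_betw (\<pi> \<circ> t) (young_diagram \<mu>) {1..sum_list \<mu>}"
    using assms by (auto simp: tableaux_def intro: bij_betw_trans permutes_imp_bij)
  ultimately show ?thesis
    using assms(1) by (simp add: tableaux_def)
qed

lemma act_basis_vector:
  assumes "\<pi> permutes A"
  shows "act \<pi> (basis_vector T) = basis_vector ((\<lambda>t. \<pi> \<circ> t) ` T)"
proof -
  have 1: "inv \<pi> \<circ> (\<pi> \<circ> t) = t" "\<pi> \<circ> (inv \<pi> \<circ> t) = t" for t :: tableau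
    using permutes_inv_o[OF assms] by (simp_all flip: comp_assoc)
  have "(\<lambda>t. inv \<pi> \<circ> t) ` (\<lambda>t. \<pi> \<circ> t) ` Y = Y"
       "(\<lambda>t. \<pi> \<circ> t) ` (\<lambda>t. inv \<pi> \<circ> t) ` Y = Y" for Y :: "tableau set"
    by (simp_all only: image_image 1 image_ident)
  then have "(\<lambda>t. inv \<pi> \<circ> t) ` X = T \<longleftrightarrow> X = (\<lambda>t. \<pi> \<circ> t) ` T" for X
    by metis
  then show ?thesis
    by (simp add: act_def basis_vector_def)
qed

lemma comp_mem_row_stabilizer:
  assumes "\<sigma> \<in> row_stabilizer \<mu> t" "\<pi> permutes {1..sum_list \<mu>}"
  shows "\<pi> \<circ> \<sigma> \<circ> inv \<pi> \<in> row_stabilizer \<mu> (\<pi> \<circ> t)"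
proof -
  have "inv \<pi> permutes {1..sum_list \<mu>}" "\<sigma> permutes {1..sum_list \<mu>}"
    using assms by (auto simp: permutes_inv row_stabilizer_def)
  then have "\<pi> \<circ> \<sigma> \<circ> inv \<pi> permutes {1..sum_list \<mu>}"
    using assms(2) by (intro permutes_compose)
  moreover have "inv \<pi> (\<pi> x) = x" for x
    using assms(2) by (simp add: permutes_inverses)
  ultimately show ?thesis
    using assms(1) unfolding row_stabilizer_def by fastforce
qed

lemma image_tabloid:
  assumes "\<pi> permutes {1..sum_list \<mu>}"
  shows "(\<lambda>s. \<pi> \<circ> s) ` tabloid \<mu> t = tabloid \<mu> (\<pi> \<circ> t)"
proof
  have 1: "\<pi> \<circ> (\<sigma> \<circ> t) = (\<pi> \<circ> \<sigma> \<circ> inv \<pi>) \<circ> (\<pi> \<circ> t)" for \<sigma>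
    using assms by (auto simp: fun_eq_iff permutes_inverses)
  show "(\<lambda>s. \<pi> \<circ> s) ` tabloid \<mu> t \<subseteq> tabloid \<mu> (\<pi> \<circ> t)"
    unfolding tabloid_def using comp_mem_row_stabilizer[OF _ assms] 1 by auto
  have inv: "inv \<pi> permutes {1..sum_list \<mu>}"
    using assms by (rule permutes_inv)
  show "tabloid \<mu> (\<pi> \<circ> t) \<subseteq> (\<lambda>s. \<pi> \<circ> s) ` tabloid \<mu> t"
  proof
    fix s assume "s \<in> tabloid \<mu> (\<pi> \<circ> t)"
    then obtain \<sigma> where \<sigma>: "\<sigma> \<in> row_stabilizer \<mu> (\<pi> \<circ> t)" and s: "s = \<sigma> \<circ> (\<pi> \<circ> t)"
      by (auto simp: tabloid_def)
    have "inv \<pi> \<circ> \<sigma> \<circ> \<pi> \<in> row_stabilizer \<mu> t"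
      using comp_mem_row_stabilizer[OF \<sigma> inv] assms
      by (simp add: permutes_inv_inv permutes_inv_o flip: comp_assoc)
    moreover have "s = \<pi> \<circ> ((inv \<pi> \<circ> \<sigma> \<circ> \<pi>) \<circ> t)"
      using assms by (auto simp: s fun_eq_iff permutes_inverses)
    ultimately show "s \<in> (\<lambda>s. \<pi> \<circ> s) ` tabloid \<mu> t"
      by (auto simp: tabloid_def)
  qed
qed

lemma specht_module_subset: "specht_module \<mu> \<subseteq> permutation_module \<mu>"
  unfolding specht_module_def permutation_module_def
proof (rule fun_space.span_minimal)
  show "polytabloid \<mu> ` tableaux \<mu>
      \<subseteq> fun_space.span (basis_vector ` tabloid \<mu> ` tableaux \<mu>)"
  proof (rule image_subsetI)
    fix t assume "t \<in> tableaux \<mu>"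
    then have "basis_vector (tabloid \<mu> (\<pi> \<circ> t)) \<in> basis_vector ` tabloid \<mu> ` tableaux \<mu>"
      if "\<pi> \<in> column_stabilizer \<mu> t" for \<pi>
      using that by (intro imageI comp_mem_tableaux) (auto simp: column_stabilizer_def)
    then show "polytabloid \<mu> t \<in> fun_space.span (basis_vector ` tabloid \<mu> ` tableaux \<mu>)"
      unfolding polytabloid_def
      by (intro fun_space.span_sum fun_space.span_scale fun_space.span_base)
  qed
qed (rule fun_space.subspace_span)

lemma finite_young_diagram: "finite (young_diagram \<mu>)"
proof -
  have "young_diagram \<mu> = (SIGMA i:{..<length \<mu>}. {..<\<mu> ! i})"
    by (auto simp: young_diagram_def)
  then show ?thesis by simp
qed

lemma finite_tableaux: "finite (tableaux \<mu>)"
proof (rule finite_subset)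
  show "tableaux \<mu> \<subseteq> {t. (\<forall>x. (x \<in> young_diagram \<mu> \<longrightarrow> t x \<in> {1..sum_list \<mu>}) \<and>
                              (x \<notin> young_diagram \<mu> \<longrightarrow> t x = 0))}"
    unfolding tableaux_def bij_betw_def by blast
  show "finite {t. (\<forall>x. (x \<in> young_diagram \<mu> \<longrightarrow> t x \<in> {1..sum_list \<mu>}) \<and>
                       (x \<notin> young_diagram \<mu> \<longrightarrow> t x = (0::nat)))}"
    by (rule finite_set_of_finite_funs) (auto simp: finite_young_diagram)
qed

lemma subspace_specht_hom: "map_space.subspace
    (specht_hom n \<alpha> \<beta> :: ('a::field tabloid_vector \<Rightarrow> 'a tabloid_vector) set)"
proof (rule map_space.subspaceI)
  have S: "0 \<in> specht_module \<mu>" "v \<in> specht_module \<mu> \<Longrightarrow> w \<in> specht_module \<mu> \<Longrightarrow> v + w \<in> specht_module \<mu>"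
      "v \<in> specht_module \<mu> \<Longrightarrow> fun_scale c v \<in> specht_module \<mu>"
    for \<mu> c and v w :: "'a tabloid_vector"
    by (simp_all add: specht_module_def fun_space.span_zero fun_space.span_add fun_space.span_scale)
  have act: "act \<pi> 0 = 0" "act \<pi> (v + w) = act \<pi> v + act \<pi> w"
      "act \<pi> (fun_scale c v) = fun_scale c (act \<pi> v)"
    for \<pi> c and v w :: "'a tabloid_vector"
    by (simp_all add: act_def fun_scale_def fun_eq_iff)
  let ?H = "specht_hom n \<alpha> \<beta> :: ('a tabloid_vector \<Rightarrow> 'a tabloid_vector) set"
  show "0 \<in> ?H"
    by (simp add: specht_hom_def S act)
  show "f + g \<in> ?H"
    if "f \<in> ?H" "g \<in> ?H" for f g
    using that by (simp add: specht_hom_def S act fun_space.scale_right_distrib)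
  show "map_scale c f \<in> ?H" if "f \<in> ?H" for c f
    using that by (simp add: specht_hom_def S act map_scale_def fun_space.scale_right_distrib
        mult.commute)
qed

text \<open>The library's \<open>dim\<close> is 0 on spaces without a finite basis; that does not occur here.\<close>

lemma specht_hom_finite_dimensional:
  "\<exists>B. finite B \<and>
    (specht_hom n \<alpha> \<beta> :: ('a::field tabloid_vector \<Rightarrow> 'a tabloid_vector) set) \<subseteq> map_space.span B"
proof -
  let ?S = "specht_module \<alpha> :: 'a tabloid_vector set"
  let ?Q = "polytabloid \<beta> ` tableaux \<beta> :: 'a tabloid_vector set"
  obtain B :: "'a tabloid_vector set" where B: "B \<subseteq> polytabloid \<alpha> ` tableaux \<alpha>" "fun_space.independent B"
      "polytabloid \<alpha> ` tableaux \<alpha> \<subseteq> fun_space.span B"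
    using fun_space.maximal_independent_subset by blast
  have span_B: "?S = fun_space.span B"
    unfolding specht_module_def
    using B by (intro antisym fun_space.span_mono fun_space.span_minimal) auto
  have fin: "finite B" "finite ?Q"
    using B(1) by (auto intro: finite_subset simp: finite_tableaux)
  have B_S: "b \<in> ?S" if "b \<in> B" for b
    using that by (simp add: span_B fun_space.span_base)
  define E where "E = (\<lambda>(b, q :: 'a tabloid_vector) v. if v \<in> ?S
      then fun_scale (fun_space.representation B v b) q else 0)"
  have apply_sum: "(\<Sum>i\<in>I. f i) v = (\<Sum>i\<in>I. f i v)"
    for I :: "'i set" and f :: "'i \<Rightarrow> 'a tabloid_vector \<Rightarrow> 'a tabloid_vector" and v
    by (induction I rule: infinite_finite_induct) auto
  have "h \<in> map_space.span (E ` (B \<times> ?Q))" if h: "h \<in> specht_hom n \<alpha> \<beta>"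
    for h :: "'a tabloid_vector \<Rightarrow> 'a tabloid_vector"
  proof -
    have lin: "h (\<Sum>b\<in>X. fun_scale (r b) b) = (\<Sum>b\<in>X. fun_scale (r b) (h b))"
      if "X \<subseteq> ?S" "finite X" for X r
      using that(2,1)
    proof induction
      case empty
      have "0 \<in> ?S" by (simp add: specht_module_def fun_space.span_zero)
      then have "h (fun_scale 0 0) = fun_scale 0 (h 0)"
        using h unfolding specht_hom_def by blast
      then show ?case by (simp add: zero_fun_def)
    next
      case (insert b X)
      have "(\<Sum>b\<in>X. fun_scale (r b) b) \<in> ?S" "b \<in> ?S" "fun_scale (r b) b \<in> ?S"
        using insert.prems unfolding specht_module_def
        by (auto intro!: fun_space.span_sum fun_space.span_scale)
      then have "h (fun_scale (r b) b + (\<Sum>b\<in>X. fun_scale (r b) b))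
          = fun_scale (r b) (h b) + h (\<Sum>b\<in>X. fun_scale (r b) b)"
        using h unfolding specht_hom_def by simp
      with insert.IH insert.prems show ?case
        by (simp only: sum.insert[OF insert.hyps] insert_subset simp_thms)
    qed
    have "\<exists>c. h b = (\<Sum>q\<in>?Q. fun_scale (c q) q)" if "b \<in> B" for b
    proof -
      have "h b \<in> fun_space.span ?Q"
        using h B_S[OF that] by (auto simp: specht_hom_def specht_module_def)
      then show ?thesis
        unfolding fun_space.span_finite[OF fin(2)] by blast
    qed
    then have "\<exists>c. \<forall>b\<in>B. h b = (\<Sum>q\<in>?Q. fun_scale (c b q) q)"
      by (intro bchoice ballI)
    then obtain c where c: "h b = (\<Sum>q\<in>?Q. fun_scale (c b q) q)" if "b \<in> B" for b
      by blast
    have "h v = (\<Sum>(b, q)\<in>B \<times> ?Q. map_scale (c b q) (E (b, q))) v" for v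
    proof (cases "v \<in> ?S")
      case True
      let ?r = "fun_space.representation B v"
      have v: "(\<Sum>b\<in>B. fun_scale (?r b) b) = v"
        using True B(2) fin(1) by (intro fun_space.sum_representation_eq) (auto simp: span_B)
      have 1: "fun_scale (?r b) (h b) = (\<Sum>q\<in>?Q. map_scale (c b q) (E (b, q)) v)"
        if "b \<in> B" for b
        unfolding c[OF that] fun_space.scale_sum_right
        using True by (intro sum.cong refl) (simp add: E_def map_scale_def mult.commute)
      have "h v = (\<Sum>b\<in>B. fun_scale (?r b) (h b))"
        using lin[of B ?r] B_S fin(1) unfolding v by blast
      also have "\<dots> = (\<Sum>b\<in>B. \<Sum>q\<in>?Q. map_scale (c b q) (E (b, q)) v)"
        by (intro sum.cong refl 1)
      also have "\<dots> = (\<Sum>(b, q)\<in>B \<times> ?Q. map_scale (c b q) (E (b, q)) v)"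
        by (rule sum.cartesian_product)
      finally show ?thesis
        unfolding apply_sum case_prod_unfold .
    next
      case False
      then have "h v = 0" using h unfolding specht_hom_def by blast
      also have "0 = (\<Sum>(b, q)\<in>B \<times> ?Q. map_scale (c b q) (E (b, q)) v)"
        using False by (intro sum.neutral[symmetric]) (auto simp: E_def map_scale_def)
      finally show ?thesis
        unfolding apply_sum case_prod_unfold .
    qed
    then have "h = (\<Sum>(b, q)\<in>B \<times> ?Q. map_scale (c b q) (E (b, q)))" by blast
    moreover have "(case x of (b, q) \<Rightarrow> map_scale (c b q) (E (b, q)))
        \<in> map_space.span (E ` (B \<times> ?Q))" if "x \<in> B \<times> ?Q" for x
      using map_space.span_scale[OF map_space.span_base[OF imageI[OF that, of E]]]
      by (cases x) simp
    ultimately show ?thesis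
      by (metis (lifting) map_space.span_sum)
  qed
  with fin show ?thesis
    by (intro exI[of _ "E ` (B \<times> ?Q)"]) auto
qed

end

(* Fix a tableau t of shape alpha and a homomorphism h, and write f(w) for the coefficient of h(e_t)
   at the tabloid of shape beta whose row function is w.  The element e_t alternates under the column
   stabilizer and satisfies the Garnir relations, and the Specht module of beta is killed by the maps
   moving one entry of a tabloid to an earlier row; all three are linear relations among the f(w).
   By alternation f(w) vanishes unless w is injective on the columns of t, and up to sign it depends
   only on the set of values of each column.  As beta arises from alpha by moving one node, from row a
   to row b say, such a w differs little from the filling of each column of length l by 0, ..., l-1:
   there is none unless a < b, and then for each k with a < k <= b exactly one column C(k) has one
   value below k too few.  The relations rewrite f(w) by coefficients for which the set of the columns
   C(k) is larger or lies further to the right, until C(k) is the last column of length at least k.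
   So f vanishes as soon as its value at this one filling does, that is, h is determined up to a scalar. *)
theory Submission
  imports Defs
begin

section \<open>Fillings of the columns of a tableau and their deficiencies\<close>

text \<open>In the application \<open>P\<close> is {1..n}, \<open>col p\<close> is the column of the
  entry \<open>p\<close> in a tableau of shape \<alpha>, and \<open>w p\<close> is the row of
  \<open>p\<close> in a tabloid of shape \<beta>. The rows \<open>a\<close> and \<open>b\<close> are
  those that lose and gain the moved node.\<close>

locale column_fillings =
  fixes P :: "'p set" and col :: "'p \<Rightarrow> nat" and a b :: nat
  assumes finite_P: "finite P"
    and col_antimono: "y \<le> y' \<Longrightarrow> card {p\<in>P. col p = y'} \<le> card {p\<in>P. col p = y}"
    and a_neq_b: "a \<noteq> b"
begin

definition len :: "nat \<Rightarrow> nat" where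
  "len y = card {p\<in>P. col p = y}"

definition below :: "('p \<Rightarrow> nat) \<Rightarrow> nat \<Rightarrow> nat \<Rightarrow> nat" where
  "below w y k = card {p\<in>P. col p = y \<and> w p < k}"

text \<open>An injective column has at most \<open>min (len y) k\<close> values below
  \<open>k\<close>, and the values 0, ..., \<open>len y - 1\<close> attain this bound for every
  \<open>k\<close>. So \<open>k\<close> is a threshold between rows, not a row.\<close>

definition deficient :: "('p \<Rightarrow> nat) \<Rightarrow> nat \<Rightarrow> nat \<Rightarrow> bool" where
  "deficient w k y \<longleftrightarrow> below w y k < min (len y) k"

definition column_injective :: "('p \<Rightarrow> nat) \<Rightarrow> bool" where
  "column_injective w \<longleftrightarrow> (\<forall>p\<in>P. \<forall>q\<in>P. col p = col q \<longrightarrow> w p = w q \<longrightarrow> p = q)"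

text \<open>The second conjunct says that \<open>w\<close> has the row lengths of \<beta>, expressed
  through those of \<alpha>. The \<open>of_bool\<close> terms stand on opposite sides to avoid
  truncated subtraction.\<close>

definition filling :: "('p \<Rightarrow> nat) \<Rightarrow> bool" where
  "filling w \<longleftrightarrow> column_injective w \<and>
     (\<forall>i. card {p\<in>P. w p = i} + of_bool (i = a) = card {y. i < len y} + of_bool (i = b))"

text \<open>The condition singles out the last column of length at least \<open>k\<close>, so it
  leaves one candidate for the deficient column at each threshold.\<close>

definition canonical :: "('p \<Rightarrow> nat) \<Rightarrow> bool" where
  "canonical w \<longleftrightarrow> filling w \<and>
     (\<forall>k y. deficient w k y \<longrightarrow> k \<le> len y \<and> (\<forall>z>y. len z < k))"

lemma len_antimono: "y \<le> y' \<Longrightarrow> len y' \<le> len y"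
  using col_antimono by (simp add: len_def)

lemma len_pos_iff: "0 < len y \<longleftrightarrow> y \<in> col ` P"
  using finite_P by (auto simp: len_def card_gt_0_iff)

lemma below_le:
  assumes "filling w"
  shows "below w y k \<le> min (len y) k"
proof -
  have "below w y k \<le> len y"
    unfolding below_def len_def using finite_P by (intro card_mono) auto
  moreover have "below w y k \<le> card {..<k}"
    unfolding below_def using assms
    by (intro card_inj_on_le[where f = w])
       (auto simp: filling_def column_injective_def inj_on_def)
  ultimately show ?thesis by simp
qed

lemma below_Suc:
  assumes "filling w"
  shows "below w y (Suc k) = below w y k + of_bool (\<exists>p\<in>P. col p = y \<and> w p = k)"
proof (cases "\<exists>p\<in>P. col p = y \<and> w p = k")
  case True
  then obtain p where p: "p \<in> P" "col p = y" "w p = k" by blast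
  have "{q\<in>P. col q = y \<and> w q < Suc k} = insert p {q\<in>P. col q = y \<and> w q < k}"
    using assms p by (auto simp: filling_def column_injective_def less_Suc_eq)
  then show ?thesis
    using True p finite_P by (simp add: below_def)
next
  case False
  then have "{q\<in>P. col q = y \<and> w q < Suc k} = {q\<in>P. col q = y \<and> w q < k}"
    by (auto simp: less_Suc_eq)
  then show ?thesis
    using False by (auto simp: below_def)
qed

text \<open>The same entries are counted by columns and by values; \<open>sum_min_len\<close> does
  this for the nodes in the first \<open>k\<close> rows of the diagram of \<alpha>.\<close>

lemma sum_below: "(\<Sum>y\<in>col ` P. below w y k) = (\<Sum>i<k. card {p\<in>P. w p = i})"
proof -
  have "(\<Sum>y\<in>col ` P. below w y k) = card (\<Union>y\<in>col ` P. {p\<in>P. col p = y \<and> w p < k})"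
    unfolding below_def using finite_P by (intro card_UN_disjoint[symmetric]) auto
  also have "(\<Union>y\<in>col ` P. {p\<in>P. col p = y \<and> w p < k}) = (\<Union>i\<in>{..<k}. {p\<in>P. w p = i})"
    by auto
  also have "card \<dots> = (\<Sum>i<k. card {p\<in>P. w p = i})"
    using finite_P by (intro card_UN_disjoint) auto
  finally show ?thesis .
qed

lemma sum_min_len: "(\<Sum>y\<in>col ` P. min (len y) k) = (\<Sum>i<k. card {y. i < len y})"
proof -
  have "min (len y) k = (\<Sum>i<k. of_bool (i < len y))" for y
  proof -
    have "{..<k} \<inter> {i. i < len y} = {..<min (len y) k}" by auto
    then show ?thesis by (simp add: sum.If_cases of_bool_def)
  qed
  then have "(\<Sum>y\<in>col ` P. min (len y) k) = (\<Sum>y\<in>col ` P. \<Sum>i<k. of_bool (i < len y))"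
    by simp
  also have "\<dots> = (\<Sum>i<k. \<Sum>y\<in>col ` P. of_bool (i < len y))"
    by (rule sum.swap)
  also have "\<dots> = (\<Sum>i<k. card {y. i < len y})"
  proof (intro sum.cong refl)
    fix i
    have "col ` P \<inter> {y. i < len y} = {y. i < len y}"
      using len_pos_iff by fastforce
    then show "(\<Sum>y\<in>col ` P. of_bool (i < len y)) = card {y. i < len y}"
      using finite_P by (simp add: of_bool_def sum.If_cases)
  qed
  finally show ?thesis .
qed

lemma sum_below_min:
  assumes "filling w"
  shows "(\<Sum>y\<in>col ` P. below w y k) + of_bool (a < k) = (\<Sum>y\<in>col ` P. min (len y) k) + of_bool (b < k)"
proof -
  have 1: "(\<Sum>i<k. of_bool (i = c)) = (of_bool (c < k) :: nat)" for c
    by (simp add: of_bool_def)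
  have "(\<Sum>i<k. card {p\<in>P. w p = i} + of_bool (i = a)) = (\<Sum>i<k. card {y. i < len y} + of_bool (i = b))"
    using assms by (simp add: filling_def)
  then show ?thesis
    by (simp only: sum.distrib 1 sum_below sum_min_len)
qed

text \<open>If \<open>b < a\<close>, row \<open>b\<close> gains its node before row \<open>a\<close>
  loses one, and the first \<open>b + 1\<close> rows would hold more entries than
  \<open>below_le\<close> permits.\<close>

lemma filling_less:
  assumes "filling w"
  shows "a < b"
proof (rule ccontr)
  assume "\<not> a < b"
  then have "b < a" using a_neq_b by simp
  have "(\<Sum>y\<in>col ` P. below w y (Suc b)) \<le> (\<Sum>y\<in>col ` P. min (len y) (Suc b))"
    by (intro sum_mono below_le assms)
  with sum_below_min[OF assms, of "Suc b"] \<open>b < a\<close> show False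
    by simp
qed

text \<open>Strictly after row \<open>a\<close> and up to row \<open>b\<close>, the initial rows of
  \<beta> hold one node fewer than those of \<alpha>; elsewhere they hold equally many. Hence at
  each threshold in this range exactly one column lacks exactly one value, and at other thresholds
  none does.\<close>

lemma sum_deficiency:
  assumes "filling w"
  shows "(\<Sum>y\<in>col ` P. min (len y) k - below w y k) = of_bool (a < k \<and> k \<le> b)"
proof -
  have "(\<Sum>y\<in>col ` P. min (len y) k - below w y k)
      = (\<Sum>y\<in>col ` P. min (len y) k) - (\<Sum>y\<in>col ` P. below w y k)"
    by (intro sum_subtractf_nat below_le assms)
  with sum_below_min[OF assms, of k] filling_less[OF assms] show ?thesis
    by (auto simp: of_bool_def split: if_splits)
qed

lemma deficient_in_cols: "deficient w k y \<Longrightarrow> y \<in> col ` P"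
  unfolding len_pos_iff[symmetric] by (auto simp: deficient_def)

lemma deficiency:
  assumes "filling w"
  shows "below w y k + of_bool (deficient w k y) = min (len y) k"
proof (cases "deficient w k y")
  case True
  then have "min (len y) k - below w y k \<le> (\<Sum>y\<in>col ` P. min (len y) k - below w y k)"
    using finite_P deficient_in_cols by (intro member_le_sum) auto
  also have "\<dots> \<le> 1"
    by (simp add: sum_deficiency[OF assms])
  finally show ?thesis
    using True by (auto simp: deficient_def min_def split: if_splits)
next
  case False
  then show ?thesis
    using below_le[OF assms, of y k] by (auto simp: deficient_def)
qed

lemma deficient_range:
  assumes "filling w" "deficient w k y"
  shows "a < k" "k \<le> b"
proof -
  have "min (len y) k - below w y k \<le> (\<Sum>y\<in>col ` P. min (len y) k - below w y k)"
    using finite_P deficient_in_cols assms(2) by (intro member_le_sum) auto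
  then show "a < k" "k \<le> b"
    using assms(2) sum_deficiency[OF assms(1), of k] by (auto simp: deficient_def of_bool_def split: if_splits)
qed

lemma deficient_unique:
  assumes "filling w" "deficient w k y" "deficient w k z"
  shows "y = z"
proof (rule ccontr)
  assume "y \<noteq> z"
  let ?g = "\<lambda>y. min (len y) k - below w y k"
  have "?g y + ?g z = sum ?g {y, z}" using \<open>y \<noteq> z\<close> by simp
  also have "\<dots> \<le> sum ?g (col ` P)"
    using finite_P deficient_in_cols assms by (intro sum_mono2) auto
  also have "\<dots> \<le> 1"
    by (simp add: sum_deficiency[OF assms(1)])
  finally show False
    using assms(2,3) unfolding deficient_def by linarith
qed

lemma deficient_exists:
  assumes "filling w" "a < k" "k \<le> b"
  shows "\<exists>y. deficient w k y"
proof (rule ccontr)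
  assume "\<not> (\<exists>y. deficient w k y)"
  then have "(\<Sum>y\<in>col ` P. min (len y) k - below w y k) = 0"
    by (intro sum.neutral) (metis deficient_def diff_is_0_eq not_less)
  with sum_deficiency[OF assms(1), of k] assms show False by simp
qed

text \<open>This is the difference of \<open>deficiency\<close> at the thresholds \<open>k\<close>
  and \<open>Suc k\<close>. It recovers the set of values of a column from the thresholds at which
  the column is deficient.\<close>

lemma value_iff:
  assumes "filling w"
  shows "of_bool (\<exists>p\<in>P. col p = y \<and> w p = k) + of_bool (deficient w (Suc k) y)
    = of_bool (k < len y) + (of_bool (deficient w k y) :: nat)"
proof -
  have "min (len y) (Suc k) = min (len y) k + of_bool (k < len y)" by auto
  then show ?thesis
    using deficiency[OF assms, of y k] deficiency[OF assms, of y "Suc k"] below_Suc[OF assms, of y k]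
    by linarith
qed

text \<open>The right side of \<open>value_iff\<close> is 2, so both terms on its left are 1. A
  deficiency can therefore end only beyond the length of its column.\<close>

lemma deficient_step:
  assumes "filling w" "deficient w k y" "k < len y"
  shows "deficient w (Suc k) y"
proof (rule ccontr)
  assume "\<not> deficient w (Suc k) y"
  with value_iff[OF assms(1), of y k] assms(2,3) show False
    by (simp add: of_bool_def split: if_splits)
qed

lemma deficient_start:
  assumes "filling w" "deficient w (Suc k) y" "\<not> deficient w k y"
  shows "k < len y" "\<not> (\<exists>p\<in>P. col p = y \<and> w p = k)"
proof -
  define has where "has \<longleftrightarrow> (\<exists>p\<in>P. col p = y \<and> w p = k)"
  have "of_bool has + 1 = (of_bool (k < len y) :: nat)"
    using value_iff[OF assms(1), of y k] assms(2,3) unfolding has_def[symmetric] by simp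
  then have "k < len y \<and> \<not> has"
    by (cases has; cases "k < len y") auto
  then show "k < len y" "\<not> (\<exists>p\<in>P. col p = y \<and> w p = k)"
    unfolding has_def by auto
qed

lemma deficient_persists:
  assumes "filling w" "deficient w k y" "k \<le> j" "j \<le> len y"
  shows "deficient w j y"
  using assms(3,4)
proof (induction j rule: dec_induct)
  case (step j)
  then show ?case using deficient_step[OF assms(1)] by simp
qed (use assms in simp)

lemma column_values_cong:
  assumes "filling w" "filling w'" "deficient w = deficient w'"
  shows "(\<exists>p\<in>P. col p = y \<and> w p = k) \<longleftrightarrow> (\<exists>p\<in>P. col p = y \<and> w' p = k)"
proof -
  have "of_bool (\<exists>p\<in>P. col p = y \<and> w p = k) = (of_bool (\<exists>p\<in>P. col p = y \<and> w' p = k) :: nat)"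
    using value_iff[OF assms(1), of y k] value_iff[OF assms(2), of y k] unfolding assms(3)
    by linarith
  then show ?thesis by (simp only: of_bool_eq_iff)
qed

lemma canonical_unique:
  assumes "canonical w" "canonical w'"
  shows "deficient w = deficient w'"
proof -
  have *: "deficient w' k y" if w: "canonical w" "canonical w'" and y: "deficient w k y" for w w' k y
  proof -
    have "a < k" "k \<le> b"
      using w y deficient_range by (auto simp: canonical_def)
    then obtain z where z: "deficient w' k z"
      using w deficient_exists unfolding canonical_def by blast
    \<comment> \<open>Both are the last column of length at least \<open>k\<close>.\<close>
    have "y = z"
      using w y z by (metis canonical_def linorder_neqE_nat not_less)
    with z show ?thesis by simp
  qed
  show ?thesis
    using *[OF assms] *[OF assms(2,1)] by blast
qed

text \<open>By \<open>column_values_cong\<close> the two fillings have the same values in each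
  column, each taken once; \<pi> matches the places of equal values.\<close>

lemma column_permutation:
  assumes "filling w" "filling w'" "deficient w = deficient w'"
  obtains \<pi> where "\<pi> permutes P" "\<And>p. p \<in> P \<Longrightarrow> col (\<pi> p) = col p" "\<And>p. p \<in> P \<Longrightarrow> w' p = w (\<pi> p)"
proof -
  define \<pi> where "\<pi> p = (if p \<in> P then (THE q. q \<in> P \<and> col q = col p \<and> w q = w' p) else p)" for p
  have *: "\<pi> p \<in> P \<and> col (\<pi> p) = col p \<and> w (\<pi> p) = w' p" if "p \<in> P" for p
  proof -
    have "\<exists>!q. q \<in> P \<and> col q = col p \<and> w q = w' p"
      using column_values_cong[OF assms, of "col p" "w' p"] that assms(1)
      unfolding filling_def column_injective_def by metis
    from theI'[OF this] show ?thesis using that by (simp add: \<pi>_def)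
  qed
  have "inj_on \<pi> P"
  proof (rule inj_onI)
    fix p q assume "p \<in> P" "q \<in> P" "\<pi> p = \<pi> q"
    then have "col p = col q" "w' p = w' q" using *[of p] *[of q] by simp_all
    with \<open>p \<in> P\<close> \<open>q \<in> P\<close> assms(2) show "p = q"
      unfolding filling_def column_injective_def by blast
  qed
  then have "bij_betw \<pi> P P"
    unfolding bij_betw_def using endo_inj_surj[of P \<pi>] finite_P * by blast
  then have "\<pi> permutes P"
    by (intro bij_imp_permutes) (auto simp: \<pi>_def)
  with * that show ?thesis by auto
qed

text \<open>The column of \<open>p\<close> trades the value \<open>w p\<close> for the smaller value
  \<open>w q\<close>, which affects its counts only at thresholds above \<open>w q\<close> and up to
  \<open>w p\<close>.\<close>

lemma below_swap:
  assumes "p \<in> P" "q \<in> P" "col p \<noteq> col q" "w q \<le> w p"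
  shows "below (w \<circ> transpose p q) (col p) k = below w (col p) k + of_bool (w q < k \<and> k \<le> w p)"
    and "below w (col q) k = below (w \<circ> transpose p q) (col q) k + of_bool (w q < k \<and> k \<le> w p)"
    and "y \<noteq> col p \<Longrightarrow> y \<noteq> col q \<Longrightarrow> below (w \<circ> transpose p q) y k = below w y k"
proof -
  let ?w = "w \<circ> transpose p q"
  have 0: "?w r = (if r = p then w q else if r = q then w p else w r)" for r
    by (simp add: transpose_def)
  let ?A = "\<lambda>w y. {r\<in>P. col r = y \<and> w r < k}"
  have 1: "?A ?w (col p) = (if w q < k \<and> k \<le> w p then insert p (?A w (col p)) else ?A w (col p))"
    and 2: "?A w (col q) = (if w q < k \<and> k \<le> w p then insert q (?A ?w (col q)) else ?A ?w (col q))"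
    and 3: "y \<noteq> col p \<Longrightarrow> y \<noteq> col q \<Longrightarrow> ?A ?w y = ?A w y"
    using assms unfolding 0 by (auto split: if_splits)
  show "below ?w (col p) k = below w (col p) k + of_bool (w q < k \<and> k \<le> w p)"
    unfolding below_def 1 using finite_P by (auto simp: of_bool_def)
  show "below w (col q) k = below ?w (col q) k + of_bool (w q < k \<and> k \<le> w p)"
    unfolding below_def 2 using finite_P 0 assms by (auto simp: of_bool_def)
  show "below ?w y k = below w y k" if "y \<noteq> col p" "y \<noteq> col q"
    unfolding below_def 3[OF that] ..
qed

text \<open>By \<open>below_le\<close> the column of \<open>p\<close> has room to gain a value below
  \<open>k\<close> only if it was deficient at \<open>k\<close>, and then it was the only one.
  Symmetrically, the column of \<open>q\<close> is the only one afterwards. So the exchange carries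
  the deficiency at these thresholds from one column to the other.\<close>

lemma deficient_swap:
  assumes w: "filling w" and w': "filling (w \<circ> transpose p q)"
    and "p \<in> P" "q \<in> P" "col p \<noteq> col q" "w q \<le> w p"
  shows "w q < k \<Longrightarrow> k \<le> w p \<Longrightarrow> deficient w k y \<longleftrightarrow> y = col p"
    and "w q < k \<Longrightarrow> k \<le> w p \<Longrightarrow> deficient (w \<circ> transpose p q) k y \<longleftrightarrow> y = col q"
    and "\<not> (w q < k \<and> k \<le> w p) \<Longrightarrow> deficient (w \<circ> transpose p q) k y \<longleftrightarrow> deficient w k y"
proof -
  note s = below_swap[OF assms(3-6)]
  have 1: "deficient w k (col p)" "deficient (w \<circ> transpose p q) k (col q)" if "w q < k \<and> k \<le> w p"
    using that s(1,2)[of k] below_le[OF w, of "col q" k] below_le[OF w', of "col p" k]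
    by (auto simp: deficient_def)
  show "w q < k \<Longrightarrow> k \<le> w p \<Longrightarrow> deficient w k y \<longleftrightarrow> y = col p"
    "w q < k \<Longrightarrow> k \<le> w p \<Longrightarrow> deficient (w \<circ> transpose p q) k y \<longleftrightarrow> y = col q"
    using 1 deficient_unique[OF w] deficient_unique[OF w'] by blast+
  show "deficient (w \<circ> transpose p q) k y \<longleftrightarrow> deficient w k y" if "\<not> (w q < k \<and> k \<le> w p)"
    using that s(1,2)[of k] s(3)[of y k] unfolding deficient_def
    by (cases "y = col p"; cases "y = col q") (auto simp: of_bool_def split: if_splits)
qed

definition profile :: "('p \<Rightarrow> nat) \<Rightarrow> (nat \<times> nat) set" where
  "profile w = {(k, y). deficient w k y}"

text \<open>Each column that is deficient somewhere counts once, however many thresholds are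
  involved. With \<open>Suc\<close> even column 0 contributes, so enlarging the set of these columns
  always raises the weight.\<close>

definition weight :: "('p \<Rightarrow> nat) \<Rightarrow> nat" where
  "weight w = (\<Sum>y\<in>snd ` profile w. Suc y)"

lemma finite_profile: "filling w \<Longrightarrow> finite (profile w)"
  using deficient_range deficient_in_cols finite_P
  by (intro finite_subset[of "profile w" "{..b} \<times> col ` P"]) (auto simp: profile_def)

lemma weight_le: "weight w \<le> (\<Sum>y\<in>col ` P. Suc y)"
  unfolding weight_def using finite_P deficient_in_cols
  by (intro sum_mono2) (auto simp: profile_def)

end


section \<open>Rewriting a nonzero coefficient towards the canonical filling\<close>

text \<open>\<open>f\<close> stands for the coefficients, on the tabloids of shape \<open>\<beta>\<close>, of the image of a
  polytabloid of shape \<open>\<alpha>\<close>.  The Garnir relations give \<open>garnir\<close>; \<open>kernel\<close> says that the image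
  is killed by the maps that move one entry of a tabloid to an earlier row.\<close>

locale column_moves = column_fillings P col a b
  for P :: "'p set" and col a b +
  fixes f :: "('p \<Rightarrow> nat) \<Rightarrow> 'a::field"
  assumes filling: "f w \<noteq> 0 \<Longrightarrow> filling w"
    and alternating: "\<pi> permutes P \<Longrightarrow> (\<And>p. p \<in> P \<Longrightarrow> col (\<pi> p) = col p) \<Longrightarrow>
        f (w \<circ> \<pi>) = of_int (sign \<pi>) * f w"
    and garnir: "u \<in> P \<Longrightarrow> y < col u \<Longrightarrow> f w = (\<Sum>z | z \<in> P \<and> col z = y. f (w \<circ> transpose z u))"
    and kernel: "p \<in> P \<Longrightarrow> i < w p \<Longrightarrow> f w = - (\<Sum>q | q \<in> P \<and> w q = i. f (w \<circ> transpose p q))"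
    and cong: "(\<And>p. p \<in> P \<Longrightarrow> w p = w' p) \<Longrightarrow> f w = f w'"
begin

text \<open>The deficiency of a column ends at \<open>K\<close>, beyond its length. By
  \<open>value_iff\<close> the column then contains \<open>K\<close> but not \<open>K - 1\<close>,
  and is deficient at \<open>K - 1\<close> too. Exchanging the value \<open>K\<close> with some
  \<open>K - 1\<close> by \<open>kernel\<close> passes only the deficiency at \<open>K\<close> to
  another column, which lies further left. Either that column is new and the weight grows, or the
  weight stays and the columns in the profile have a smaller sum.\<close>

lemma swap_down:
  assumes nz: "f w \<noteq> 0" and K: "deficient w K (col p)" "\<not> deficient w (Suc K) (col p)"
    and len: "len (col p) < K"
  obtains w' where "f w' \<noteq> 0" "weight w < weight w' \<or>
      weight w = weight w' \<and> sum snd (profile w') < sum snd (profile w)"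
proof -
  let ?Y = "col p"
  note w = filling[OF nz]
  obtain k where k: "K = Suc k" using len by (cases K) auto
  have "\<exists>r\<in>P. col r = ?Y \<and> w r = K"
    using value_iff[OF w, of ?Y K] K len by (auto simp: of_bool_def split: if_splits)
  then obtain r where r: "r \<in> P" "col r = ?Y" "w r = K" by blast
  have low: "deficient w k ?Y" "\<not> (\<exists>r\<in>P. col r = ?Y \<and> w r = k)"
    using value_iff[OF w, of ?Y k] K(1) len unfolding k by (auto simp: of_bool_def split: if_splits)
  have "(\<Sum>q | q \<in> P \<and> w q = k. f (w \<circ> transpose r q)) \<noteq> 0"
    using kernel[of r k w] r k nz by auto
  then obtain q where q: "q \<in> P" "w q = k" and nz': "f (w \<circ> transpose r q) \<noteq> 0"
    by (auto elim!: sum.not_neutral_contains_not_neutral)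
  let ?w' = "w \<circ> transpose r q"
  note w' = filling[OF nz']
  have cols: "col r \<noteq> col q" "w q \<le> w r"
    using low(2) q r k by auto
  note s = deficient_swap[OF w w' r(1) q(1) cols]
  have range: "w q < j \<and> j \<le> w r \<longleftrightarrow> j = K" for j
    using q r k by auto
  have p': "profile ?w' = insert (K, col q) (profile w - {(K, ?Y)})"
  proof (intro equalityI subrelI)
    fix j y
    show "(j, y) \<in> insert (K, col q) (profile w - {(K, ?Y)})" if "(j, y) \<in> profile ?w'"
      using that s[of j y] range[of j] r(2) by (cases "j = K") (auto simp: profile_def)
    show "(j, y) \<in> profile ?w'" if "(j, y) \<in> insert (K, col q) (profile w - {(K, ?Y)})"
      using that s[of j y] range[of j] r(2) by (cases "j = K") (auto simp: profile_def)
  qed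
  have "(K, ?Y) \<in> profile w" "(K, col q) \<notin> profile w"
    using K(1) cols(1) r(2) s(1)[of K "col q"] range[of K] by (auto simp: profile_def)
  have fin: "finite (profile w)" "finite (profile ?w')"
    using finite_profile w w' by blast+
  \<comment> \<open>The threshold \<open>k\<close> keeps the original column among the deficient
    ones.\<close>
  have "(k, ?Y) \<in> profile w - {(K, ?Y)}"
    using low(1) k by (simp add: profile_def)
  then have "?Y \<in> snd ` (profile w - {(K, ?Y)})"
    by (metis image_eqI snd_conv)
  moreover have "snd ` profile w = insert ?Y (snd ` (profile w - {(K, ?Y)}))"
    using \<open>(K, ?Y) \<in> profile w\<close> by (metis image_insert insert_Diff snd_conv)
  ultimately have img: "snd ` profile ?w' = insert (col q) (snd ` profile w)"
    unfolding p' by (simp add: insert_absorb)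
  \<comment> \<open>This column contains \<open>k\<close> and is not deficient at \<open>k\<close>,
    so it is longer than \<open>k\<close>, whereas the column of \<open>p\<close> is not.\<close>
  have "k < len (col q)"
    using value_iff[OF w, of "col q" k] q low(1) deficient_unique[OF w low(1), of "col q"] cols r(2)
    by (auto simp: of_bool_def split: if_splits)
  then have less: "col q < ?Y"
    using len_antimono[of ?Y "col q"] len k by (meson leD leI le_less_trans less_Suc_eq_le order_le_less_trans)
  show ?thesis
  proof (cases "col q \<in> snd ` profile w")
    case True
    have "sum snd (profile w) = ?Y + sum snd (profile w - {(K, ?Y)})"
      using sum.remove[OF fin(1) \<open>(K, ?Y) \<in> profile w\<close>, of snd] by simp
    moreover have "sum snd (profile ?w') = col q + sum snd (profile w - {(K, ?Y)})"
      unfolding p' using fin(1) \<open>(K, col q) \<notin> profile w\<close> by (subst sum.insert) auto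
    ultimately show ?thesis
      using less img True that[OF nz'] by (simp add: weight_def insert_absorb)
  next
    case False
    then have "weight w < weight ?w'"
      unfolding weight_def img using fin(1) by simp
    with nz' that show ?thesis by blast
  qed
qed

text \<open>Column \<open>y\<close> lacks the value \<open>k\<close>, where its deficiency starts,
  although a later column \<open>z\<close> is long enough to contain \<open>k\<close>. The Garnir
  relation for the entry of \<open>z\<close> with value \<open>k\<close> and the whole column
  \<open>y\<close> transfers the deficiency at \<open>Suc k\<close> to \<open>z\<close>, and the
  weight grows because \<open>z\<close> is new and lies further right.\<close>

lemma garnir_right:
  assumes nz: "f w \<noteq> 0" and K: "deficient w (Suc k) y" "\<not> deficient w k y"
    and z: "y < z" "k < len z"
  obtains w' where "f w' \<noteq> 0" "weight w < weight w'"
proof -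
  note w = filling[OF nz]
  have y: "k < len y" "\<not> (\<exists>p\<in>P. col p = y \<and> w p = k)"
    using deficient_start[OF w K] by auto
  have len: "len z \<le> len y" using z len_antimono by simp
  \<comment> \<open>If \<open>z\<close> were deficient as well, \<open>deficient_persists\<close>
    would make both columns deficient at a common threshold, the later of their two starting
    points.\<close>
  have z_full: "\<not> deficient w j z" for j
  proof (induction j)
    case 0
    then show ?case using deficient_range(1)[OF w] by blast
  next
    case (Suc j)
    show ?case
    proof
      assume j: "deficient w (Suc j) z"
      then have "j < len z" using deficient_start[OF w j] Suc by blast
      show False
      proof (cases "k \<le> j")
        case True
        then have "deficient w (Suc j) y"
          using deficient_persists[OF w K(1), of "Suc j"] \<open>j < len z\<close> len by simp
        then show False using deficient_unique[OF w j] z by blast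
      next
        case False
        then have "deficient w (Suc k) z"
          using deficient_persists[OF w j, of "Suc k"] z by simp
        then show False using deficient_unique[OF w K(1)] z by blast
      qed
    qed
  qed
  then have z_values: "(\<exists>p\<in>P. col p = z \<and> w p = j) \<longleftrightarrow> j < len z" for j
    using value_iff[OF w, of z j] by (auto simp: of_bool_def split: if_splits)
  obtain u where u: "u \<in> P" "col u = z" "w u = k"
    using z_values[of k] z by blast
  have "(\<Sum>q | q \<in> P \<and> col q = y. f (w \<circ> transpose q u)) \<noteq> 0"
    using garnir[of u y w] u z nz by simp
  then obtain q where q: "q \<in> P" "col q = y" and nz': "f (w \<circ> transpose q u) \<noteq> 0"
    by (auto elim!: sum.not_neutral_contains_not_neutral)
  let ?w' = "w \<circ> transpose q u"
  note w' = filling[OF nz']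
  have "w q \<noteq> k" using y q by blast
  \<comment> \<open>A value below \<open>k\<close> occurs in column \<open>z\<close> already and
    would occur there twice after the exchange.\<close>
  have "k \<le> w q"
  proof (rule ccontr)
    assume "\<not> k \<le> w q"
    then obtain r where r: "r \<in> P" "col r = z" "w r = w q"
      using z_values[of "w q"] z by (meson leI le_less_trans less_imp_le not_less)
    have "r \<noteq> u" "r \<noteq> q" using r u q z \<open>w q \<noteq> k\<close> by auto
    then have "?w' r = ?w' u" using r by (simp add: transpose_def)
    then show False
      using w' r u \<open>r \<noteq> u\<close> unfolding filling_def column_injective_def by metis
  qed
  have cols: "col q \<noteq> col u" "w u \<le> w q" using q u z \<open>k \<le> w q\<close> by auto
  note s = deficient_swap[OF w w' q(1) u(1) cols]
  \<comment> \<open>Column \<open>y\<close> may or may not stay deficient; every other deficient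
    column does, since only deficiencies of \<open>y\<close> are moved.\<close>
  have "snd ` profile w - {y} \<subseteq> snd ` profile ?w'"
  proof
    fix x assume "x \<in> snd ` profile w - {y}"
    then obtain j where j: "deficient w j x" "x \<noteq> y" by (auto simp: profile_def)
    then have "deficient ?w' j x" using s(1,3)[of j x] q by blast
    then show "x \<in> snd ` profile ?w'" by (force simp: profile_def)
  qed
  moreover have "deficient ?w' (Suc k) z"
    using s(2)[of "Suc k" z] u \<open>k \<le> w q\<close> \<open>w q \<noteq> k\<close> by simp
  then have "z \<in> snd ` profile ?w'" by (force simp: profile_def)
  ultimately have sub: "insert z (snd ` profile w - {y}) \<subseteq> snd ` profile ?w'" by blast
  have zn: "z \<notin> snd ` profile w" and yin: "y \<in> snd ` profile w"
    using z_full K(1) by (force simp: profile_def)+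
  have fin: "finite (snd ` profile w)" "finite (snd ` profile ?w')"
    using finite_profile w w' by blast+
  have "weight w = Suc y + (\<Sum>y\<in>snd ` profile w - {y}. Suc y)"
    unfolding weight_def by (rule sum.remove[OF fin(1) yin])
  also have "\<dots> < Suc z + (\<Sum>y\<in>snd ` profile w - {y}. Suc y)"
    using z by simp
  also have "\<dots> = (\<Sum>y\<in>insert z (snd ` profile w - {y}). Suc y)"
    using fin zn by (subst sum.insert) auto
  also have "\<dots> \<le> weight ?w'"
    unfolding weight_def using fin sub by (intro sum_mono2) auto
  finally show ?thesis using that nz' by blast
qed

lemma improve:
  assumes nz: "f w \<noteq> 0" and nc: "\<not> canonical w"
  obtains w' where "f w' \<noteq> 0" "weight w < weight w' \<or>
      weight w = weight w' \<and> sum snd (profile w') < sum snd (profile w)"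
proof -
  note w = filling[OF nz]
  obtain k y where ky: "deficient w k y" "len y < k \<or> (\<exists>z>y. k \<le> len z)"
    using nc w by (auto simp: canonical_def not_le not_less)
  show ?thesis
  proof (cases "len y < k")
    case True
    \<comment> \<open>The greatest threshold is taken so that the deficiency of \<open>y\<close>
      ends there, as \<open>swap_down\<close> requires.\<close>
    define K where "K = (GREATEST k. deficient w k y)"
    have bound: "j \<le> b" if "deficient w j y" for j
      using deficient_range(2)[OF w that] .
    have "deficient w K y"
      unfolding K_def using ky(1) bound by (rule GreatestI_nat)
    moreover have "k \<le> K"
      unfolding K_def using ky(1) bound by (rule Greatest_le_nat)
    moreover have "\<not> deficient w (Suc K) y"
      using Greatest_le_nat[of "\<lambda>k. deficient w k y" "Suc K" b] bound unfolding K_def by auto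
    moreover obtain p where "y = col p"
      using deficient_in_cols[OF ky(1)] by blast
    ultimately show ?thesis
      using swap_down[OF nz, of K p] True that by auto
  next
    case False
    then obtain z where z: "y < z" "k \<le> len z" using ky by blast
    \<comment> \<open>The least threshold is taken so that the deficiency of its column starts
      there, as \<open>garnir_right\<close> requires: otherwise the preceding threshold would
      qualify with the same two columns.\<close>
    define K where "K = (LEAST j. \<exists>y z. deficient w j y \<and> y < z \<and> j \<le> len z)"
    have "\<exists>y z. deficient w K y \<and> y < z \<and> K \<le> len z"
      unfolding K_def using ky(1) z by (intro LeastI[where P = "\<lambda>j. \<exists>y z. deficient w j y \<and> y < z \<and> j \<le> len z"]) blast
    then obtain y z where yz: "deficient w K y" "y < z" "K \<le> len z" by blast
    obtain k where k: "K = Suc k"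
      using deficient_range(1)[OF w yz(1)] by (cases K) auto
    have "\<not> (\<exists>y z. deficient w k y \<and> y < z \<and> k \<le> len z)"
      using not_less_Least[of k "\<lambda>j. \<exists>y z. deficient w j y \<and> y < z \<and> j \<le> len z"]
      unfolding K_def[symmetric] k by simp
    then have "\<not> deficient w k y"
      using yz(2,3) k by (meson Suc_leD)
    then show ?thesis
      using garnir_right[OF nz, of k y z] yz k that by auto
  qed
qed

lemma canonical_nonzero:
  assumes "f w \<noteq> 0"
  shows "\<exists>w'. f w' \<noteq> 0 \<and> canonical w'"
proof -
  define N where "N = (\<Sum>y\<in>col ` P. Suc y)"
  \<comment> \<open>Since \<open>N\<close> bounds the weight by \<open>weight_le\<close>, a growing
    weight is a decreasing first component.\<close>
  define r where "r = inv_image (less_than <*lex*> less_than) (\<lambda>w. (N - weight w, sum snd (profile w)))"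
  have "wf r" by (auto simp: r_def)
  then show ?thesis using assms
  proof (induction w rule: wf_induct_rule)
    case (less w)
    show ?case
    proof (cases "canonical w")
      case False
      then obtain w' where w': "f w' \<noteq> 0" "weight w < weight w' \<or>
          weight w = weight w' \<and> sum snd (profile w') < sum snd (profile w)"
        using improve less.prems by blast
      have "(w', w) \<in> r"
        using w'(2) weight_le[of w'] by (auto simp: r_def N_def)
      then show ?thesis using less.IH w'(1) by blast
    qed (use less.prems in blast)
  qed
qed

text \<open>Canonical fillings differ only by permutations within the columns, under which
  \<open>f\<close> changes at most its sign.\<close>

lemma canonical_nonzero_all:
  assumes "f w \<noteq> 0" "canonical w'"
  shows "f w' \<noteq> 0"
proof -
  obtain v where v: "f v \<noteq> 0" "canonical v"
    using canonical_nonzero assms by blast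
  obtain \<pi> where \<pi>: "\<pi> permutes P" "\<And>p. p \<in> P \<Longrightarrow> col (\<pi> p) = col p" "\<And>p. p \<in> P \<Longrightarrow> w' p = v (\<pi> p)"
    using column_permutation[of v w'] v(2) assms(2) canonical_unique[OF v(2) assms(2)]
    unfolding canonical_def by blast
  have "f w' = f (v \<circ> \<pi>)" using \<pi>(3) by (intro cong) simp
  also have "\<dots> = of_int (sign \<pi>) * f v" using \<pi>(1,2) by (rule alternating)
  finally show ?thesis using v(1) by (auto simp: sign_def)
qed

end

section \<open>Tabloids given by row functions, and coefficients of polytabloids\<close>

text \<open>The function \<open>w\<close> assigns a row to each entry. If it does not have the row
  lengths of the shape, the set is empty and hence not a tabloid, and elements of
  \<open>permutation_module\<close> vanish there.\<close>

definition tabloid_of :: "nat list \<Rightarrow> (nat \<Rightarrow> nat) \<Rightarrow> tableau set" where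
  "tabloid_of \<mu> w = {s\<in>tableaux \<mu>. \<forall>x\<in>young_diagram \<mu>. w (s x) = fst x}"

definition position :: "nat list \<Rightarrow> tableau \<Rightarrow> nat \<Rightarrow> nat \<times> nat" where
  "position \<mu> t = inv_into (young_diagram \<mu>) t"

lemma tableau_bij: "t \<in> tableaux \<mu> \<Longrightarrow> bij_betw t (young_diagram \<mu>) {1..sum_list \<mu>}"
  by (simp add: tableaux_def)

lemma position_tableau [simp]:
  "t \<in> tableaux \<mu> \<Longrightarrow> x \<in> young_diagram \<mu> \<Longrightarrow> position \<mu> t (t x) = x"
  using tableau_bij by (metis bij_betw_def inv_into_f_f position_def)

lemma tableau_position:
  assumes "t \<in> tableaux \<mu>" "p \<in> {1..sum_list \<mu>}"
  shows "t (position \<mu> t p) = p" "position \<mu> t p \<in> young_diagram \<mu>"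
proof -
  have "p \<in> t ` young_diagram \<mu>"
    using tableau_bij[OF assms(1)] assms(2) by (simp add: bij_betw_def)
  then show "t (position \<mu> t p) = p" "position \<mu> t p \<in> young_diagram \<mu>"
    unfolding position_def by (rule f_inv_into_f, rule inv_into_into)
qed

lemma tableau_mem: "t \<in> tableaux \<mu> \<Longrightarrow> x \<in> young_diagram \<mu> \<Longrightarrow> t x \<in> {1..sum_list \<mu>}"
  using tableau_bij by (blast dest: bij_betwE)

lemma tableau_inj:
  "t \<in> tableaux \<mu> \<Longrightarrow> x \<in> young_diagram \<mu> \<Longrightarrow> y \<in> young_diagram \<mu> \<Longrightarrow> t x = t y \<Longrightarrow> x = y"
  by (metis position_tableau)

lemma tableau_permutation:
  assumes "t \<in> tableaux \<mu>" "s \<in> tableaux \<mu>"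
  obtains \<sigma> where "\<sigma> permutes {1..sum_list \<mu>}" "s = \<sigma> \<circ> t"
proof -
  define \<sigma> where "\<sigma> p = (if p \<in> {1..sum_list \<mu>} then s (position \<mu> t p) else p)" for p
  have "bij_betw (s \<circ> position \<mu> t) {1..sum_list \<mu>} {1..sum_list \<mu>}"
    unfolding position_def
    by (rule bij_betw_trans[OF bij_betw_inv_into[OF tableau_bij[OF assms(1)]] tableau_bij[OF assms(2)]])
  then have "bij_betw \<sigma> {1..sum_list \<mu>} {1..sum_list \<mu>}"
    by (rule bij_betw_cong[THEN iffD1, rotated]) (simp add: \<sigma>_def)
  then have "\<sigma> permutes {1..sum_list \<mu>}"
    by (intro bij_imp_permutes) (auto simp: \<sigma>_def)
  moreover have "s x = \<sigma> (t x)" for x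
  proof (cases "x \<in> young_diagram \<mu>")
    case True
    then show ?thesis using tableau_mem[OF assms(1) True] assms(1) by (simp add: \<sigma>_def)
  next
    case False
    then have "t x = 0" "s x = 0" using assms unfolding tableaux_def by blast+
    then show ?thesis by (simp add: \<sigma>_def)
  qed
  ultimately show ?thesis using that by (auto simp: fun_eq_iff)
qed

text \<open>Membership is rephrased for entries instead of nodes, to match the map
  \<open>col\<close> of the locale.\<close>

lemma column_stabilizer_iff:
  assumes t: "t \<in> tableaux \<mu>"
  shows "\<pi> \<in> column_stabilizer \<mu> t \<longleftrightarrow> \<pi> permutes {1..sum_list \<mu>} \<and>
    (\<forall>p\<in>{1..sum_list \<mu>}. snd (position \<mu> t (\<pi> p)) = snd (position \<mu> t p))"
proof (intro iffI conjI ballI)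
  assume \<pi>: "\<pi> \<in> column_stabilizer \<mu> t"
  then show "\<pi> permutes {1..sum_list \<mu>}" by (simp add: column_stabilizer_def)
  fix p assume p: "p \<in> {1..sum_list \<mu>}"
  obtain i j where ij: "position \<mu> t p = (i, j)" by fastforce
  have "(i, j) \<in> young_diagram \<mu>" "t (i, j) = p"
    using tableau_position[OF t p] ij by simp_all
  then obtain k where "(k, j) \<in> young_diagram \<mu>" "\<pi> p = t (k, j)"
    using \<pi> unfolding column_stabilizer_def by fastforce
  then show "snd (position \<mu> t (\<pi> p)) = snd (position \<mu> t p)"
    using t ij by simp
next
  assume \<pi>: "\<pi> permutes {1..sum_list \<mu>} \<and>
    (\<forall>p\<in>{1..sum_list \<mu>}. snd (position \<mu> t (\<pi> p)) = snd (position \<mu> t p))"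
  have "\<exists>k. (k, j) \<in> young_diagram \<mu> \<and> \<pi> (t (i, j)) = t (k, j)" if ij: "(i, j) \<in> young_diagram \<mu>" for i j
  proof -
    have p: "t (i, j) \<in> {1..sum_list \<mu>}" using t ij by (rule tableau_mem)
    then have "\<pi> (t (i, j)) \<in> {1..sum_list \<mu>}" using \<pi> permutes_in_image[of \<pi>] by blast
    note pos = tableau_position[OF t this]
    have "snd (position \<mu> t (\<pi> (t (i, j)))) = j"
      using \<pi> p position_tableau[OF t ij] by (metis snd_conv)
    with pos show ?thesis by (metis prod.collapse)
  qed
  with \<pi> show "\<pi> \<in> column_stabilizer \<mu> t"
    by (auto simp: column_stabilizer_def)
qed

lemma tabloid_eq:
  assumes t: "t \<in> tableaux \<mu>"
  shows "tabloid \<mu> t = tabloid_of \<mu> (\<lambda>p. fst (position \<mu> t p))"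
proof (intro equalityI subsetI)
  fix s assume "s \<in> tabloid \<mu> t"
  then obtain \<sigma> where \<sigma>: "\<sigma> \<in> row_stabilizer \<mu> t" and s: "s = \<sigma> \<circ> t"
    by (auto simp: tabloid_def)
  have "s \<in> tableaux \<mu>"
    unfolding s using \<sigma> t by (intro comp_mem_tableaux) (auto simp: row_stabilizer_def)
  moreover have "fst (position \<mu> t (s x)) = fst x" if "x \<in> young_diagram \<mu>" for x
  proof -
    have "\<forall>(i, j)\<in>young_diagram \<mu>. \<exists>k. (i, k) \<in> young_diagram \<mu> \<and> \<sigma> (t (i, j)) = t (i, k)"
      using \<sigma> by (simp add: row_stabilizer_def)
    from bspec[OF this that] obtain k where "(fst x, k) \<in> young_diagram \<mu>" "\<sigma> (t x) = t (fst x, k)"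
      by (cases x) auto
    then show ?thesis using t by (simp add: s)
  qed
  ultimately show "s \<in> tabloid_of \<mu> (\<lambda>p. fst (position \<mu> t p))"
    by (simp add: tabloid_of_def)
next
  fix s assume s: "s \<in> tabloid_of \<mu> (\<lambda>p. fst (position \<mu> t p))"
  then have st: "s \<in> tableaux \<mu>" by (simp add: tabloid_of_def)
  then obtain \<sigma> where \<sigma>: "\<sigma> permutes {1..sum_list \<mu>}" "s = \<sigma> \<circ> t"
    using tableau_permutation[OF t] by blast
  have "\<exists>k. (i, k) \<in> young_diagram \<mu> \<and> \<sigma> (t (i, j)) = t (i, k)" if ij: "(i, j) \<in> young_diagram \<mu>" for i j
  proof -
    have "fst (position \<mu> t (s (i, j))) = i"
      using s ij by (auto simp: tabloid_of_def)
    with tableau_position[OF t tableau_mem[OF st ij]] \<sigma>(2) show ?thesis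
      by (metis comp_apply prod.collapse)
  qed
  with \<sigma>(1) have "\<sigma> \<in> row_stabilizer \<mu> t"
    by (auto simp: row_stabilizer_def)
  then show "s \<in> tabloid \<mu> t"
    using \<sigma>(2) by (auto simp: tabloid_def)
qed

lemma tabloid_of_cong:
  assumes "\<And>p. p \<in> {1..sum_list \<mu>} \<Longrightarrow> w p = w' p"
  shows "tabloid_of \<mu> w = tabloid_of \<mu> w'"
proof -
  have "w (s x) = w' (s x)" if "s \<in> tableaux \<mu>" "x \<in> young_diagram \<mu>" for s x
    using assms tableau_mem that by blast
  then show ?thesis by (auto simp: tabloid_of_def)
qed

lemma tabloid_of_mem:
  assumes "s \<in> tabloid_of \<mu> w"
  shows "tabloid_of \<mu> w = tabloid \<mu> s"
proof -
  have s: "s \<in> tableaux \<mu>" using assms by (simp add: tabloid_of_def)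
  have "w p = fst (position \<mu> s p)" if "p \<in> {1..sum_list \<mu>}" for p
    using tableau_position[OF s that] assms by (auto simp: tabloid_of_def)
  then show ?thesis
    unfolding tabloid_eq[OF s] by (rule tabloid_of_cong)
qed

lemma self_mem_tabloid: "t \<in> tableaux \<mu> \<Longrightarrow> t \<in> tabloid \<mu> t"
  by (simp add: tabloid_eq tabloid_of_def)

lemma basis_vector_tabloid_of:
  assumes "s \<in> tableaux \<mu>"
  shows "basis_vector (tabloid \<mu> s) (tabloid_of \<mu> w) = of_bool (s \<in> tabloid_of \<mu> w)"
proof (cases "s \<in> tabloid_of \<mu> w")
  case True
  then show ?thesis using tabloid_of_mem[OF True] by (simp add: basis_vector_def)
next
  case False
  then have "tabloid_of \<mu> w \<noteq> tabloid \<mu> s" using self_mem_tabloid[OF assms] by blast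
  with False show ?thesis by (simp add: basis_vector_def)
qed

lemma sum_apply: "(\<Sum>i\<in>I. f i) x = (\<Sum>i\<in>I. f i x)"
  for f :: "'i \<Rightarrow> 'b \<Rightarrow> 'a::comm_monoid_add"
  by (induction I rule: infinite_finite_induct) auto

lemma finite_column_stabilizer: "finite (column_stabilizer \<mu> t)"
  by (rule finite_subset[OF _ finite_permutations[of "{1..sum_list \<mu>}"]])
     (auto simp: column_stabilizer_def)

text \<open>The coefficient becomes a signed count of column permutations, to which sign-reversing
  involutions apply.\<close>

lemma polytabloid_tabloid_of:
  assumes t: "t \<in> tableaux \<mu>"
  shows "polytabloid \<mu> t (tabloid_of \<mu> w)
    = (\<Sum>\<pi> | \<pi> \<in> column_stabilizer \<mu> t \<and> \<pi> \<circ> t \<in> tabloid_of \<mu> w. of_int (sign \<pi>) :: 'a::field)"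
proof -
  have "(polytabloid \<mu> t (tabloid_of \<mu> w) :: 'a) = (\<Sum>\<pi>\<in>column_stabilizer \<mu> t.
      of_int (sign \<pi>) * basis_vector (tabloid \<mu> (\<pi> \<circ> t)) (tabloid_of \<mu> w))"
    unfolding polytabloid_def sum_apply fun_scale_def ..
  also have "\<dots> = (\<Sum>\<pi>\<in>column_stabilizer \<mu> t.
      if \<pi> \<circ> t \<in> tabloid_of \<mu> w then of_int (sign \<pi>) else 0)"
    using t by (intro sum.cong refl)
      (simp add: basis_vector_tabloid_of comp_mem_tableaux column_stabilizer_def)
  also have "\<dots> = (\<Sum>\<pi> | \<pi> \<in> column_stabilizer \<mu> t \<and> \<pi> \<circ> t \<in> tabloid_of \<mu> w. of_int (sign \<pi>))"
    by (intro sum.inter_filter[symmetric] finite_column_stabilizer)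
  finally show ?thesis .
qed

lemma mem_tabloid_of_comp:
  assumes "\<pi> permutes {1..sum_list \<mu>}"
  shows "s \<in> tabloid_of \<mu> (w \<circ> \<pi>) \<longleftrightarrow> \<pi> \<circ> s \<in> tabloid_of \<mu> w"
proof -
  have "inv \<pi> \<circ> (\<pi> \<circ> s) = s"
    using permutes_inv_o[OF assms] by (simp flip: comp_assoc)
  then have "\<pi> \<circ> s \<in> tableaux \<mu> \<longleftrightarrow> s \<in> tableaux \<mu>"
    using comp_mem_tableaux[OF _ assms] comp_mem_tableaux[OF _ permutes_inv[OF assms]] by metis
  then show ?thesis by (simp add: tabloid_of_def)
qed

text \<open>Composing the tableaux of a tabloid with \<open>inv \<pi>\<close> composes its row
  function with \<pi>, so the inverse in \<open>act\<close> disappears.\<close>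

lemma act_tabloid_of:
  assumes "\<pi> permutes {1..sum_list \<mu>}"
  shows "act \<pi> v (tabloid_of \<mu> w) = v (tabloid_of \<mu> (w \<circ> \<pi>))"
proof -
  have 1: "inv \<pi> \<circ> (\<pi> \<circ> s) = s" "\<pi> \<circ> (inv \<pi> \<circ> s) = s" for s :: tableau
    using permutes_inv_o[OF assms] by (simp_all flip: comp_assoc)
  have "(\<lambda>s. inv \<pi> \<circ> s) ` tabloid_of \<mu> w = tabloid_of \<mu> (w \<circ> \<pi>)"
  proof (intro equalityI subsetI)
    fix s assume "s \<in> tabloid_of \<mu> (w \<circ> \<pi>)"
    then show "s \<in> (\<lambda>s. inv \<pi> \<circ> s) ` tabloid_of \<mu> w"
      using mem_tabloid_of_comp[OF assms] by (intro image_eqI[where x = "\<pi> \<circ> s"]) (simp_all add: 1)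
  qed (auto simp: mem_tabloid_of_comp[OF assms] 1)
  then show ?thesis by (simp add: act_def)
qed

lemma act_sum: "act \<pi> (\<Sum>i\<in>I. f i) = (\<Sum>i\<in>I. act \<pi> (f i))"
  by (simp add: act_def fun_eq_iff sum_apply)

lemma act_scale: "act \<pi> (fun_scale c v) = fun_scale c (act \<pi> v)"
  by (simp add: act_def fun_scale_def)

lemma permutation_module_support:
  assumes "v \<in> permutation_module \<mu>" "v X \<noteq> 0"
  shows "X \<in> tabloid \<mu> ` tableaux \<mu>"
proof (rule ccontr)
  assume X: "X \<notin> tabloid \<mu> ` tableaux \<mu>"
  have "v X = 0"
    using assms(1) unfolding permutation_module_def
  proof (induction rule: fun_space.span_induct_alt)
    case (step c x y)
    then have "x X = 0" using X unfolding basis_vector_def by auto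
    with step show ?case by (simp add: fun_scale_def)
  qed simp
  with assms(2) show False ..
qed

text \<open>Every tabloid has a row function by \<open>tabloid_eq\<close>, and both vectors vanish
  off the tabloids.\<close>

lemma permutation_module_eqI:
  assumes "v \<in> permutation_module \<mu>" "v' \<in> permutation_module \<mu>"
    and "\<And>w. v (tabloid_of \<mu> w) = v' (tabloid_of \<mu> w)"
  shows "v = v'"
proof
  fix X
  show "v X = v' X"
  proof (cases "X \<in> tabloid \<mu> ` tableaux \<mu>")
    case True
    then show ?thesis using assms(3) tabloid_eq by auto
  next
    case False
    then show ?thesis using assms(1,2) permutation_module_support by metis
  qed
qed

lemma polytabloid_mem: "t \<in> tableaux \<mu> \<Longrightarrow> polytabloid \<mu> t \<in> specht_module \<mu>"
  unfolding specht_module_def by (intro fun_space.span_base) simp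

lemma act_polytabloid_sum:
  assumes "\<pi> permutes {1..sum_list \<mu>}" "t \<in> tableaux \<mu>"
  shows "act \<pi> (polytabloid \<mu> t) = (\<Sum>\<sigma>\<in>column_stabilizer \<mu> t.
     fun_scale (of_int (sign \<sigma>)) (basis_vector (tabloid \<mu> (\<pi> \<circ> \<sigma> \<circ> t))))"
  unfolding polytabloid_def act_sum act_scale act_basis_vector[OF assms(1)] image_tabloid[OF assms(1)]
  by (simp add: comp_assoc)

text \<open>Conjugation by \<pi> maps the column stabilizer of \<open>t\<close> onto that of
  \<open>\<pi> \<circ> t\<close> and preserves signs.\<close>

lemma act_polytabloid:
  assumes \<pi>: "\<pi> permutes {1..sum_list \<mu>}" and t: "t \<in> tableaux \<mu>"
  shows "act \<pi> (polytabloid \<mu> t) = polytabloid \<mu> (\<pi> \<circ> t)"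
proof -
  have perm: "permutation \<pi>" using \<pi> permutation_permutes by blast
  have \<pi>t: "\<pi> \<circ> t \<in> tableaux \<mu>" using t \<pi> by (rule comp_mem_tableaux)
  note inv = permutes_inv[OF \<pi>]
  have "position \<mu> (\<pi> \<circ> t) p = position \<mu> t (inv \<pi> p)" if "p \<in> {1..sum_list \<mu>}" for p
  proof -
    have q: "inv \<pi> p \<in> {1..sum_list \<mu>}" using that inv permutes_in_image by metis
    have "p = (\<pi> \<circ> t) (position \<mu> t (inv \<pi> p))"
      using tableau_position[OF t q] permutes_inverses[OF \<pi>] by simp
    then show ?thesis using position_tableau[OF \<pi>t] tableau_position[OF t q] by metis
  qed
  note pos = this
  have *: "\<sigma> \<in> column_stabilizer \<mu> (\<pi> \<circ> t) \<longleftrightarrow> inv \<pi> \<circ> \<sigma> \<circ> \<pi> \<in> column_stabilizer \<mu> t"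
    if \<sigma>: "\<sigma> permutes {1..sum_list \<mu>}" for \<sigma>
  proof -
    have "inv \<pi> \<circ> \<sigma> \<circ> \<pi> permutes {1..sum_list \<mu>}"
      using \<sigma> \<pi> inv by (intro permutes_compose)
    moreover have "(\<forall>p\<in>{1..sum_list \<mu>}. snd (position \<mu> (\<pi> \<circ> t) (\<sigma> p)) = snd (position \<mu> (\<pi> \<circ> t) p))
      \<longleftrightarrow> (\<forall>p\<in>{1..sum_list \<mu>}. snd (position \<mu> t (inv \<pi> (\<sigma> p))) = snd (position \<mu> t (inv \<pi> p)))"
      using pos permutes_in_image[OF \<sigma>] by (intro ball_cong refl) metis
    moreover have "\<dots> \<longleftrightarrow> (\<forall>p\<in>\<pi> ` {1..sum_list \<mu>}. snd (position \<mu> t (inv \<pi> (\<sigma> p))) = snd (position \<mu> t (inv \<pi> p)))"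
      using permutes_image[OF \<pi>] by simp
    moreover have "\<dots> \<longleftrightarrow> (\<forall>p\<in>{1..sum_list \<mu>}. snd (position \<mu> t (inv \<pi> (\<sigma> (\<pi> p)))) = snd (position \<mu> t p))"
      using permutes_inverses[OF \<pi>] by simp
    ultimately show ?thesis
      unfolding column_stabilizer_iff[OF t] column_stabilizer_iff[OF \<pi>t] using \<sigma> by auto
  qed
  have c: "inv \<pi> \<circ> (\<pi> \<circ> g) = g" "\<pi> \<circ> (inv \<pi> \<circ> g) = g" for g :: "'b \<Rightarrow> nat"
    using permutes_inv_o[OF \<pi>] by (simp_all flip: comp_assoc)
  show ?thesis
    unfolding act_polytabloid_sum[OF \<pi> t] polytabloid_def[of _ "\<pi> \<circ> t"]
  proof (rule sum.reindex_bij_witness[of _ "\<lambda>\<sigma>. inv \<pi> \<circ> \<sigma> \<circ> \<pi>" "\<lambda>\<sigma>. \<pi> \<circ> \<sigma> \<circ> inv \<pi>"])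
    fix \<sigma> assume \<sigma>: "\<sigma> \<in> column_stabilizer \<mu> t"
    then have p: "\<sigma> permutes {1..sum_list \<mu>}" by (simp add: column_stabilizer_def)
    then have p': "\<pi> \<circ> \<sigma> \<circ> inv \<pi> permutes {1..sum_list \<mu>}"
      using \<pi> inv by (intro permutes_compose)
    show e: "inv \<pi> \<circ> (\<pi> \<circ> \<sigma> \<circ> inv \<pi>) \<circ> \<pi> = \<sigma>"
      using permutes_inv_o[OF \<pi>] by (simp add: c comp_assoc)
    show "\<pi> \<circ> \<sigma> \<circ> inv \<pi> \<in> column_stabilizer \<mu> (\<pi> \<circ> t)"
      using *[OF p'] e \<sigma> by simp
    have "permutation \<sigma>" using p permutation_permutes by blast
    then have "sign (\<pi> \<circ> \<sigma> \<circ> inv \<pi>) = sign \<sigma>"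
      using perm by (simp add: sign_compose permutation_compose permutation_inverse sign_inverse)
    then show "fun_scale (of_int (sign (\<pi> \<circ> \<sigma> \<circ> inv \<pi>))) (basis_vector (tabloid \<mu> (\<pi> \<circ> \<sigma> \<circ> inv \<pi> \<circ> (\<pi> \<circ> t))))
       = fun_scale (of_int (sign \<sigma>)) (basis_vector (tabloid \<mu> (\<pi> \<circ> \<sigma> \<circ> t)))"
      by (simp add: c comp_assoc)
  next
    fix \<sigma> assume \<sigma>: "\<sigma> \<in> column_stabilizer \<mu> (\<pi> \<circ> t)"
    then have "\<sigma> permutes {1..sum_list \<mu>}" by (simp add: column_stabilizer_def)
    then show "inv \<pi> \<circ> \<sigma> \<circ> \<pi> \<in> column_stabilizer \<mu> t"
      using * \<sigma> by blast
    show "\<pi> \<circ> (inv \<pi> \<circ> \<sigma> \<circ> \<pi>) \<circ> inv \<pi> = \<sigma>"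
      using permutes_inv_o[OF \<pi>] by (simp add: c comp_assoc)
  qed
qed

text \<open>Left multiplication by \<pi> permutes the column stabilizer and multiplies every sign by
  that of \<pi>.\<close>

lemma act_polytabloid_column:
  assumes \<pi>: "\<pi> \<in> column_stabilizer \<mu> t" and t: "t \<in> tableaux \<mu>"
  shows "act \<pi> (polytabloid \<mu> t) = fun_scale (of_int (sign \<pi>)) (polytabloid \<mu> t :: 'a::field tabloid_vector)"
proof -
  have p: "\<pi> permutes {1..sum_list \<mu>}" using \<pi> by (simp add: column_stabilizer_def)
  have perm: "permutation \<pi>" using p permutation_permutes by blast
  have c: "inv \<pi> \<circ> (\<pi> \<circ> g) = g" "\<pi> \<circ> (inv \<pi> \<circ> g) = g" for g :: "'b \<Rightarrow> nat"
    using permutes_inv_o[OF p] by (simp_all flip: comp_assoc)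
  have closed: "\<rho> \<circ> \<sigma> \<in> column_stabilizer \<mu> t"
    if "\<rho> \<in> column_stabilizer \<mu> t" "\<sigma> \<in> column_stabilizer \<mu> t" for \<rho> \<sigma>
  proof -
    have "\<sigma> permutes {1..sum_list \<mu>}" "\<rho> permutes {1..sum_list \<mu>}"
      using that by (simp_all add: column_stabilizer_def)
    then show ?thesis
      using that permutes_in_image[OF \<open>\<sigma> permutes _\<close>]
      unfolding column_stabilizer_iff[OF t] by (simp add: permutes_compose)
  qed
  have inv: "inv \<pi> \<in> column_stabilizer \<mu> t"
  proof -
    have "snd (position \<mu> t (inv \<pi> p)) = snd (position \<mu> t p)" if "p \<in> {1..sum_list \<mu>}" for p
    proof -
      have "inv \<pi> p \<in> {1..sum_list \<mu>}" using that permutes_inv[OF p] permutes_in_image by metis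
      then show ?thesis
        using \<pi> permutes_inverses(1)[OF p] unfolding column_stabilizer_iff[OF t] by metis
    qed
    then show ?thesis
      unfolding column_stabilizer_iff[OF t] using permutes_inv[OF p] by blast
  qed
  have "act \<pi> (polytabloid \<mu> t) = (\<Sum>\<sigma>\<in>column_stabilizer \<mu> t.
     fun_scale (of_int (sign \<pi>)) (fun_scale (of_int (sign \<sigma>)) (basis_vector (tabloid \<mu> (\<sigma> \<circ> t)) :: 'a tabloid_vector)))"
    unfolding act_polytabloid_sum[OF p t]
  proof (rule sum.reindex_bij_witness[of _ "\<lambda>\<sigma>. inv \<pi> \<circ> \<sigma>" "\<lambda>\<sigma>. \<pi> \<circ> \<sigma>"])
    fix \<sigma> assume \<sigma>: "\<sigma> \<in> column_stabilizer \<mu> t"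
    then have "permutation \<sigma>"
      unfolding column_stabilizer_def using permutation_permutes by blast
    then have "sign (\<pi> \<circ> \<sigma>) = sign \<pi> * sign \<sigma>" using perm by (rule sign_compose[rotated])
    moreover have "sign \<pi> * (sign \<pi> * sign \<sigma>) = sign \<sigma>" by (simp add: sign_def)
    ultimately have "of_int (sign \<pi>) * (of_int (sign (\<pi> \<circ> \<sigma>)) :: 'a) = of_int (sign \<sigma>)"
      by (metis of_int_mult)
    then show "fun_scale (of_int (sign \<pi>)) (fun_scale (of_int (sign (\<pi> \<circ> \<sigma>))) (basis_vector (tabloid \<mu> (\<pi> \<circ> \<sigma> \<circ> t))))
       = fun_scale (of_int (sign \<sigma>)) (basis_vector (tabloid \<mu> (\<pi> \<circ> \<sigma> \<circ> t)) :: 'a tabloid_vector)"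
      by simp
  qed (use \<pi> inv closed c in auto)
  then show ?thesis
    unfolding polytabloid_def fun_space.scale_sum_right .
qed

section \<open>Kernel and Garnir relations\<close>

text \<open>Reindexing along the involution shows that the sum is its own negative. Fixed points do
  no harm, as 2 is invertible.\<close>

lemma sum_involution_eq_0:
  fixes g :: "'b \<Rightarrow> 'a::field"
  assumes two: "(2 :: 'a) \<noteq> 0"
    and "\<And>x. x \<in> X \<Longrightarrow> \<phi> x \<in> X" "\<And>x. x \<in> X \<Longrightarrow> \<phi> (\<phi> x) = x" "\<And>x. x \<in> X \<Longrightarrow> g (\<phi> x) = - g x"
  shows "sum g X = 0"
proof -
  have "sum g X = (\<Sum>x\<in>X. - g x)"
    using assms by (intro sum.reindex_bij_witness[of X \<phi> \<phi>]) auto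
  then have "2 * sum g X = 0" by (simp add: sum_negf eq_neg_iff_add_eq_0)
  with two show ?thesis by simp
qed

lemma young_diagram_downward:
  assumes "partition_of n \<mu>" "x \<in> young_diagram \<mu>" "i \<le> fst x" "j \<le> snd x"
  shows "(i, j) \<in> young_diagram \<mu>"
proof -
  have x: "fst x < length \<mu>" "snd x < \<mu> ! fst x"
    using assms(2) by (auto simp: young_diagram_def)
  have "\<mu> ! fst x \<le> \<mu> ! i"
  proof (cases "i = fst x")
    case False
    then show ?thesis
      using assms(1,3) x(1) sorted_wrt_nth_less[of "(\<ge>)" \<mu> i "fst x"] by (simp add: partition_of_def)
  qed simp
  with x assms(3,4) show ?thesis by (simp add: young_diagram_def)
qed

lemma column_stabilizer_column:
  assumes "t \<in> tableaux \<mu>" "\<pi> \<in> column_stabilizer \<mu> t" "x \<in> young_diagram \<mu>"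
  shows "snd (position \<mu> t (\<pi> (t x))) = snd x"
  using assms(2) tableau_mem[OF assms(1,3)] position_tableau[OF assms(1,3)]
  unfolding column_stabilizer_iff[OF assms(1)] by simp

lemma transpose_column_stabilizer:
  assumes t: "t \<in> tableaux \<mu>" and \<pi>: "\<pi> \<in> column_stabilizer \<mu> t"
    and pq: "p \<in> {1..sum_list \<mu>}" "q \<in> {1..sum_list \<mu>}" "snd (position \<mu> t p) = snd (position \<mu> t q)"
  shows "transpose p q \<circ> \<pi> \<in> column_stabilizer \<mu> t"
proof -
  have "\<pi> permutes {1..sum_list \<mu>}" using \<pi> by (simp add: column_stabilizer_def)
  then have "transpose p q \<circ> \<pi> permutes {1..sum_list \<mu>}"
    using pq by (intro permutes_compose permutes_swap_id)
  moreover have "snd (position \<mu> t (transpose p q r)) = snd (position \<mu> t r)" for r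
    using pq(3) by (simp add: transpose_def)
  ultimately show ?thesis
    using \<pi> by (simp add: column_stabilizer_iff[OF t])
qed

lemma sign_transpose_comp:
  assumes "p \<noteq> q" "\<pi> permutes S" "finite S"
  shows "sign (transpose p q \<circ> \<pi>) = - sign \<pi>"
proof -
  have "permutation \<pi>" using assms(2,3) permutation_permutes by blast
  then have "sign (transpose p q \<circ> \<pi>) = sign (transpose p q) * sign \<pi>"
    by (intro sign_compose permutation_swap_id)
  then show ?thesis using assms(1) by (simp add: sign_swap_id)
qed

text \<open>The terms cancel in pairs: the entry \<open>q\<close> moved to the later row is exchanged with the entry
  of row \<open>i\<close> in the same column.\<close>

lemma polytabloid_kernel:
  assumes two: "(2 :: 'a::field) \<noteq> 0" and part: "partition_of n \<mu>" and t: "t \<in> tableaux \<mu>"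
    and p: "p \<in> {1..sum_list \<mu>}" "i < w p"
  shows "(polytabloid \<mu> t (tabloid_of \<mu> w) :: 'a)
    = - (\<Sum>q | q \<in> {1..sum_list \<mu>} \<and> w q = i. polytabloid \<mu> t (tabloid_of \<mu> (w \<circ> transpose p q)))"
proof -
  let ?P = "{1..sum_list \<mu>}"
  define Q where "Q = {q. q \<in> ?P \<and> w q = i}"
  \<comment> \<open>\<open>C q\<close> indexes the signed count for the row function
    \<open>w \<circ> transpose p q\<close>. For \<open>q = p\<close> the transposition is the
    identity, so \<open>insert p Q\<close> collects both sides of the relation.\<close>
  define C where "C q = {\<pi>. \<pi> \<in> column_stabilizer \<mu> t \<and> \<pi> \<circ> t \<in> tabloid_of \<mu> (w \<circ> transpose p q)}" for q
  define \<phi> where "\<phi> = (\<lambda>(q, \<pi>). let q' = \<pi> (t (i, snd (position \<mu> (\<pi> \<circ> t) q))) in (q', transpose q q' \<circ> \<pi>))"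
  have main: "\<phi> (q, \<pi>) \<in> Sigma (insert p Q) C \<and> \<phi> (\<phi> (q, \<pi>)) = (q, \<pi>) \<and>
      sign (snd (\<phi> (q, \<pi>))) = - sign \<pi>"
    if q: "q \<in> insert p Q" and \<pi>: "\<pi> \<in> C q" for q \<pi>
  proof -
    define s where "s = \<pi> \<circ> t"
    have stab: "\<pi> \<in> column_stabilizer \<mu> t" and sT: "s \<in> tabloid_of \<mu> (w \<circ> transpose p q)"
      using \<pi> by (simp_all add: C_def s_def)
    have perm: "\<pi> permutes ?P" using stab by (simp add: column_stabilizer_def)
    have s: "s \<in> tableaux \<mu>" and rows: "\<And>x. x \<in> young_diagram \<mu> \<Longrightarrow> w (transpose p q (s x)) = fst x"
      using sT by (auto simp: tabloid_of_def)
    have qP: "q \<in> ?P" using q p by (auto simp: Q_def)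
    define x where "x = position \<mu> s q"
    have x: "x \<in> young_diagram \<mu>" "s x = q"
      using tableau_position[OF s qP] by (simp_all add: x_def)
    have row_x: "fst x = w p" using rows[OF x(1)] x(2) by simp
    define x' where "x' = (i, snd x)"
    have x': "x' \<in> young_diagram \<mu>"
      unfolding x'_def using p(2) row_x by (intro young_diagram_downward[OF part x(1)]) auto
    define q' where "q' = s x'"
    have q'P: "q' \<in> ?P" unfolding q'_def using s x' by (rule tableau_mem)
    have "x \<noteq> x'" using row_x p(2) by (metis x'_def fst_conv nat_neq_iff)
    then have neq: "q \<noteq> q'" using tableau_inj[OF s x(1) x'] x(2) by (auto simp: q'_def)
    have row_q': "w (transpose p q q') = i" using rows[OF x'] by (simp add: q'_def x'_def)
    have wq: "q \<noteq> p \<Longrightarrow> w q = i" using q by (auto simp: Q_def)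
    have wq': "w q' = i" if "q' \<noteq> p" using that row_q' neq by simp
    have q': "q' \<in> insert p Q"
      using wq' q'P by (auto simp: Q_def)
    have \<phi>: "\<phi> (q, \<pi>) = (q', transpose q q' \<circ> \<pi>)"
      unfolding \<phi>_def by (simp add: Let_def q'_def s_def x'_def x_def)
    have "snd (position \<mu> t q) = snd (position \<mu> t q')"
      using column_stabilizer_column[OF t stab x(1)] column_stabilizer_column[OF t stab x'] x(2)
      by (simp add: q'_def s_def x'_def)
    then have stab': "transpose q q' \<circ> \<pi> \<in> column_stabilizer \<mu> t"
      using t stab qP q'P by (intro transpose_column_stabilizer)
    have s': "transpose q q' \<circ> s \<in> tableaux \<mu>"
      using s qP q'P by (intro comp_mem_tableaux permutes_swap_id)
    \<comment> \<open>The exchange of \<open>q\<close> and \<open>q'\<close> in the tableau is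
      absorbed by passing from \<open>transpose p q\<close> to \<open>transpose p q'\<close>: the
      function \<open>w\<close> takes the value \<open>i\<close> at both entries unless one of them
      is \<open>p\<close>, and then the transpositions themselves cancel.\<close>
    have "w (transpose p q' (transpose q q' r)) = w (transpose p q r)" for r
      using wq wq' neq by (cases "r = q"; cases "r = q'"; cases "q = p"; cases "q' = p") (simp_all add: transpose_def)
    then have "transpose q q' \<circ> s \<in> tabloid_of \<mu> (w \<circ> transpose p q')"
      using s' rows by (simp add: tabloid_of_def)
    then have mem: "\<phi> (q, \<pi>) \<in> Sigma (insert p Q) C"
      unfolding \<phi> using q' stab' by (simp add: C_def s_def comp_assoc)
    have "position \<mu> (transpose q q' \<circ> s) q' = x"
      using position_tableau[OF s' x(1)] x(2) by simp
    moreover have "(transpose q q' \<circ> s) x' = q" by (simp add: q'_def)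
    ultimately have "\<phi> (q', transpose q q' \<circ> \<pi>) = (q, transpose q' q \<circ> (transpose q q' \<circ> \<pi>))"
      unfolding \<phi>_def by (simp add: Let_def s_def x'_def comp_assoc)
    also have "transpose q' q \<circ> (transpose q q' \<circ> \<pi>) = \<pi>"
      by (simp add: transpose_commute[of q' q] flip: comp_assoc)
    finally have "\<phi> (q', transpose q q' \<circ> \<pi>) = (q, \<pi>)" .
    then show ?thesis
      using mem sign_transpose_comp[OF neq perm] unfolding \<phi> snd_conv by blast
  qed
  have fin: "finite Q" "finite (C q)" for q
    unfolding Q_def C_def by (simp_all add: finite_column_stabilizer)
  have "(\<Sum>x\<in>Sigma (insert p Q) C. of_int (sign (snd x)) :: 'a) = 0"
  proof (rule sum_involution_eq_0[OF two, where \<phi> = \<phi>])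
    fix x assume x: "x \<in> Sigma (insert p Q) C"
    have m: "\<phi> x \<in> Sigma (insert p Q) C \<and> \<phi> (\<phi> x) = x \<and> sign (snd (\<phi> x)) = - sign (snd x)"
      using x main by (cases x) auto
    then show "\<phi> x \<in> Sigma (insert p Q) C" "\<phi> (\<phi> x) = x" by blast+
    show "of_int (sign (snd (\<phi> x))) = - (of_int (sign (snd x)) :: 'a)" using m by simp
  qed
  then have "(\<Sum>q\<in>insert p Q. \<Sum>\<pi>\<in>C q. of_int (sign \<pi>) :: 'a) = 0"
    using fin by (subst sum.Sigma) (auto simp: case_prod_unfold)
  moreover have "(\<Sum>\<pi>\<in>C q. of_int (sign \<pi>) :: 'a) = polytabloid \<mu> t (tabloid_of \<mu> (w \<circ> transpose p q))" for q
    unfolding C_def polytabloid_tabloid_of[OF t] ..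
  ultimately have "(\<Sum>q\<in>insert p Q. polytabloid \<mu> t (tabloid_of \<mu> (w \<circ> transpose p q)) :: 'a) = 0"
    by simp
  moreover have "p \<notin> Q" using p(2) by (simp add: Q_def)
  ultimately show ?thesis
    using fin(1) by (simp add: eq_neg_iff_add_eq_0 Q_def)
qed

text \<open>The difference of the two sides is a coefficient of the image of \<open>v\<close> under
  the map moving one entry from row \<open>w p\<close> to row \<open>i\<close>, taken at
  \<open>w\<close> with \<open>p\<close> put into row \<open>i\<close>; the moved entry is
  \<open>p\<close> or one of the \<open>q\<close>. The claim is linear in \<open>v\<close>, so
  polytabloids suffice.\<close>

lemma specht_kernel:
  assumes two: "(2 :: 'a::field) \<noteq> 0" and part: "partition_of n \<mu>"
    and v: "v \<in> (specht_module \<mu> :: 'a tabloid_vector set)"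
    and p: "p \<in> {1..sum_list \<mu>}" "i < w p"
  shows "v (tabloid_of \<mu> w) = - (\<Sum>q | q \<in> {1..sum_list \<mu>} \<and> w q = i. v (tabloid_of \<mu> (w \<circ> transpose p q)))"
  using v unfolding specht_module_def
proof (induction rule: fun_space.span_induct_alt)
  case (step c x y)
  then obtain t where "t \<in> tableaux \<mu>" "x = polytabloid \<mu> t" by blast
  then have "x (tabloid_of \<mu> w) = - (\<Sum>q | q \<in> {1..sum_list \<mu>} \<and> w q = i. x (tabloid_of \<mu> (w \<circ> transpose p q)))"
    using polytabloid_kernel[OF two part, where w = w, OF _ p] by blast
  with step show ?case
    by (simp add: fun_scale_def sum.distrib sum_distrib_left o_def)
qed simp

text \<open>The Garnir relation for a whole column and one entry \<open>u\<close> of a later column.  Its terms cancel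
  in pairs: the entry in the original place of \<open>u\<close> is exchanged with the entry of the column \<open>y\<close>
  in the same row.\<close>

lemma polytabloid_garnir:
  assumes two: "(2 :: 'a::field) \<noteq> 0" and part: "partition_of n \<mu>" and t: "t \<in> tableaux \<mu>"
    and u: "u \<in> {1..sum_list \<mu>}" "y < snd (position \<mu> t u)"
  shows "(polytabloid \<mu> t (tabloid_of \<mu> w) :: 'a)
    = (\<Sum>z | z \<in> {1..sum_list \<mu>} \<and> snd (position \<mu> t z) = y. polytabloid \<mu> t (tabloid_of \<mu> (w \<circ> transpose z u)))"
proof -
  let ?P = "{1..sum_list \<mu>}"
  let ?col = "\<lambda>p. snd (position \<mu> t p)"
  define Z where "Z = {z. z \<in> ?P \<and> ?col z = y}"
  \<comment> \<open>The members of \<open>C z\<close> are the products of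
    \<open>transpose z u\<close> with a column permutation. For \<open>z = u\<close> they give the
    coefficient of the polytabloid itself, and for \<open>z\<close> in \<open>Z\<close> that of its
    image under the transposition, with opposite signs.\<close>
  define C where "C z = {\<tau>. transpose z u \<circ> \<tau> \<in> column_stabilizer \<mu> t \<and> \<tau> \<circ> t \<in> tabloid_of \<mu> w}" for z
  define \<phi> where "\<phi> = (\<lambda>(z, \<tau>). let z' = \<tau> (t (fst (position \<mu> (\<tau> \<circ> t) z), y)) in (z', transpose z z' \<circ> \<tau>))"
  have cancel: "transpose a b \<circ> (transpose a b \<circ> g) = g" for a b and g :: "'b \<Rightarrow> nat"
    by (simp flip: comp_assoc)
  have perm: "\<tau> permutes ?P" if "z \<in> ?P" "\<tau> \<in> C z" for z \<tau>
  proof -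
    have "transpose z u \<circ> \<tau> permutes ?P" using that by (simp add: C_def column_stabilizer_def)
    then have "transpose z u \<circ> (transpose z u \<circ> \<tau>) permutes ?P"
      using that u by (metis permutes_compose permutes_swap_id)
    then show ?thesis by (simp add: cancel)
  qed
  have main: "\<phi> (z, \<tau>) \<in> Sigma (insert u Z) C \<and> \<phi> (\<phi> (z, \<tau>)) = (z, \<tau>) \<and>
      sign (snd (\<phi> (z, \<tau>))) = - sign \<tau>"
    if z: "z \<in> insert u Z" and \<tau>: "\<tau> \<in> C z" for z \<tau>
  proof -
    define s where "s = \<tau> \<circ> t"
    define \<sigma> where "\<sigma> = transpose z u \<circ> \<tau>"
    have stab: "\<sigma> \<in> column_stabilizer \<mu> t" and sT: "s \<in> tabloid_of \<mu> w"
      using \<tau> by (simp_all add: C_def s_def \<sigma>_def)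
    have s: "s \<in> tableaux \<mu>" and rows: "\<And>x. x \<in> young_diagram \<mu> \<Longrightarrow> w (s x) = fst x"
      using sT by (auto simp: tabloid_of_def)
    have zP: "z \<in> ?P" using z u by (auto simp: Z_def)
    define x where "x = position \<mu> s z"
    have x: "x \<in> young_diagram \<mu>" "s x = z"
      using tableau_position[OF s zP] by (simp_all add: x_def)
    have "\<sigma> (t x) = u" using x(2) by (simp add: \<sigma>_def s_def)
    then have col_x: "snd x = ?col u" using column_stabilizer_column[OF t stab x(1)] by simp
    define x' where "x' = (fst x, y)"
    have x': "x' \<in> young_diagram \<mu>"
      unfolding x'_def using u(2) col_x by (intro young_diagram_downward[OF part x(1)]) auto
    define z' where "z' = s x'"
    have z'P: "z' \<in> ?P" unfolding z'_def using s x' by (rule tableau_mem)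
    have "x \<noteq> x'" using col_x u(2) by (metis x'_def snd_conv nat_neq_iff)
    then have neq: "z \<noteq> z'" using tableau_inj[OF s x(1) x'] x(2) by (auto simp: z'_def)
    have "?col (transpose z u z') = y"
      using column_stabilizer_column[OF t stab x'] unfolding \<sigma>_def z'_def s_def x'_def by simp
    then have z'Z: "z' \<in> Z" if "z' \<noteq> u"
      using that neq z'P by (simp add: Z_def)
    then have z': "z' \<in> insert u Z" by blast
    have \<phi>: "\<phi> (z, \<tau>) = (z', transpose z z' \<circ> \<tau>)"
      unfolding \<phi>_def by (simp add: Let_def z'_def s_def x'_def x_def)
    \<comment> \<open>If \<open>u\<close> is one of the two exchanged entries, the column
      permutation stays the same. Otherwise commuting the transpositions multiplies it by an
      exchange within column \<open>y\<close>.\<close>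
    have stab': "transpose z' u \<circ> (transpose z z' \<circ> \<tau>) \<in> column_stabilizer \<mu> t"
    proof (cases "z' = u \<or> z = u")
      case True
      then have "transpose z' u \<circ> (transpose z z' \<circ> \<tau>) = \<sigma>"
        using cancel[of z' u \<tau>] by (auto simp: \<sigma>_def transpose_commute[of u z'])
      with stab show ?thesis by simp
    next
      case False
      then have "transpose z' u \<circ> transpose z z' = transpose z z' \<circ> transpose z u"
        using neq by (auto simp: fun_eq_iff transpose_def)
      then have "transpose z' u \<circ> (transpose z z' \<circ> \<tau>) = transpose z z' \<circ> \<sigma>"
        unfolding \<sigma>_def by (simp flip: comp_assoc)
      moreover have "?col z = ?col z'" using False z z'Z by (simp add: Z_def)
      ultimately show ?thesis
        using transpose_column_stabilizer[OF t stab zP z'P] by simp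
    qed
    have s': "transpose z z' \<circ> s \<in> tableaux \<mu>"
      using s zP z'P by (intro comp_mem_tableaux permutes_swap_id)
    \<comment> \<open>The exchanged entries lie in one row, so the tabloid is unchanged.\<close>
    have "w z = w z'" using rows[OF x(1)] rows[OF x'] x(2) by (simp add: z'_def x'_def)
    then have "w (transpose z z' r) = w r" for r by (simp add: transpose_def)
    then have "transpose z z' \<circ> s \<in> tabloid_of \<mu> w"
      using s' rows by (simp add: tabloid_of_def)
    then have mem: "\<phi> (z, \<tau>) \<in> Sigma (insert u Z) C"
      unfolding \<phi> using z' stab' by (simp add: C_def s_def comp_assoc)
    have "position \<mu> (transpose z z' \<circ> s) z' = x"
      using position_tableau[OF s' x(1)] x(2) by simp
    moreover have "(transpose z z' \<circ> s) x' = z" by (simp add: z'_def)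
    ultimately have "\<phi> (z', transpose z z' \<circ> \<tau>) = (z, transpose z' z \<circ> (transpose z z' \<circ> \<tau>))"
      unfolding \<phi>_def by (simp add: Let_def s_def x'_def comp_assoc)
    also have "transpose z' z \<circ> (transpose z z' \<circ> \<tau>) = \<tau>"
      using cancel by (simp add: transpose_commute[of z' z])
    finally have "\<phi> (z', transpose z z' \<circ> \<tau>) = (z, \<tau>)" .
    then show ?thesis
      using mem sign_transpose_comp[OF neq perm[OF zP \<tau>]] unfolding \<phi> snd_conv by blast
  qed
  have C_perm: "C z \<subseteq> {\<tau>. \<tau> permutes ?P}" if "z \<in> insert u Z" for z
    using that u perm by (auto simp: Z_def)
  have fin: "finite Z" "\<And>z. z \<in> insert u Z \<Longrightarrow> finite (C z)"
    using finite_subset[OF C_perm] finite_permutations[of ?P] unfolding Z_def by simp_all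
  have "(\<Sum>x\<in>Sigma (insert u Z) C. of_int (sign (snd x)) :: 'a) = 0"
  proof (rule sum_involution_eq_0[OF two, where \<phi> = \<phi>])
    fix x assume x: "x \<in> Sigma (insert u Z) C"
    have m: "\<phi> x \<in> Sigma (insert u Z) C \<and> \<phi> (\<phi> x) = x \<and> sign (snd (\<phi> x)) = - sign (snd x)"
      using x main by (cases x) auto
    then show "\<phi> x \<in> Sigma (insert u Z) C" "\<phi> (\<phi> x) = x" by blast+
    show "of_int (sign (snd (\<phi> x))) = - (of_int (sign (snd x)) :: 'a)" using m by simp
  qed
  then have "(\<Sum>z\<in>insert u Z. \<Sum>\<tau>\<in>C z. of_int (sign \<tau>) :: 'a) = 0"
    using fin by (subst sum.Sigma) (auto simp: case_prod_unfold)
  moreover have "u \<notin> Z" using u(2) by (simp add: Z_def)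
  moreover have "(\<Sum>\<tau>\<in>C u. of_int (sign \<tau>) :: 'a) = polytabloid \<mu> t (tabloid_of \<mu> w)"
    unfolding C_def polytabloid_tabloid_of[OF t] by simp
  moreover have "(\<Sum>\<tau>\<in>C z. of_int (sign \<tau>) :: 'a) = - polytabloid \<mu> t (tabloid_of \<mu> (w \<circ> transpose z u))"
    if z: "z \<in> Z" for z
  proof -
    have zP: "z \<in> ?P" and "z \<noteq> u" using z \<open>u \<notin> Z\<close> by (auto simp: Z_def)
    have tr: "transpose z u permutes ?P" using zP u by (intro permutes_swap_id)
    have "(\<Sum>\<tau>\<in>C z. of_int (sign \<tau>) :: 'a) = (\<Sum>\<sigma> | \<sigma> \<in> column_stabilizer \<mu> t \<and>
        \<sigma> \<circ> t \<in> tabloid_of \<mu> (w \<circ> transpose z u). - of_int (sign \<sigma>))"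
    proof (rule sum.reindex_bij_witness[of _ "\<lambda>\<sigma>. transpose z u \<circ> \<sigma>" "\<lambda>\<tau>. transpose z u \<circ> \<tau>"])
      fix \<tau> assume "\<tau> \<in> C z"
      then show "- of_int (sign (transpose z u \<circ> \<tau>)) = (of_int (sign \<tau>) :: 'a)"
        using sign_transpose_comp[OF \<open>z \<noteq> u\<close> perm[OF zP]] by simp
    qed (auto simp: cancel C_def mem_tabloid_of_comp[OF tr] comp_assoc)
    then show ?thesis by (simp add: sum_negf polytabloid_tabloid_of[OF t])
  qed
  ultimately have "polytabloid \<mu> t (tabloid_of \<mu> w)
      - (\<Sum>z\<in>Z. polytabloid \<mu> t (tabloid_of \<mu> (w \<circ> transpose z u)) :: 'a) = 0"
    using fin(1) by (simp add: sum_negf)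
  then show ?thesis by (simp add: Z_def)
qed

text \<open>The relation is lifted from coefficients to vectors so that a homomorphism can be
  applied to it.\<close>

lemma act_polytabloid_garnir:
  assumes two: "(2 :: 'a::field) \<noteq> 0" and part: "partition_of n \<mu>" and t: "t \<in> tableaux \<mu>"
    and u: "u \<in> {1..sum_list \<mu>}" "y < snd (position \<mu> t u)"
  shows "(polytabloid \<mu> t :: 'a tabloid_vector)
    = (\<Sum>z | z \<in> {1..sum_list \<mu>} \<and> snd (position \<mu> t z) = y. act (transpose z u) (polytabloid \<mu> t))"
proof (rule permutation_module_eqI[of _ \<mu>])
  let ?Z = "{z. z \<in> {1..sum_list \<mu>} \<and> snd (position \<mu> t z) = y}"
  have tr: "transpose z u permutes {1..sum_list \<mu>}" if "z \<in> ?Z" for z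
    using that u by (intro permutes_swap_id) auto
  show "polytabloid \<mu> t \<in> permutation_module \<mu>"
    using polytabloid_mem[OF t] specht_module_subset by blast
  have "act (transpose z u) (polytabloid \<mu> t) \<in> (specht_module \<mu> :: 'a tabloid_vector set)" if "z \<in> ?Z" for z
    unfolding act_polytabloid[OF tr[OF that] t] using t tr[OF that] by (intro polytabloid_mem comp_mem_tableaux)
  then show "(\<Sum>z\<in>?Z. act (transpose z u) (polytabloid \<mu> t)) \<in> (permutation_module \<mu> :: 'a tabloid_vector set)"
    using specht_module_subset unfolding permutation_module_def by (intro fun_space.span_sum) blast
  show "(polytabloid \<mu> t (tabloid_of \<mu> w) :: 'a) = (\<Sum>z\<in>?Z. act (transpose z u) (polytabloid \<mu> t)) (tabloid_of \<mu> w)" for w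
  proof -
    have "(\<Sum>z\<in>?Z. act (transpose z u) (polytabloid \<mu> t) (tabloid_of \<mu> w) :: 'a)
        = (\<Sum>z\<in>?Z. polytabloid \<mu> t (tabloid_of \<mu> (w \<circ> transpose z u)))"
      by (intro sum.cong refl) (rule act_tabloid_of[OF tr])
    then show ?thesis
      unfolding sum_apply by (simp only: polytabloid_garnir[OF two part t u, of w])
  qed
qed

section \<open>Row and column lengths of Young diagrams\<close>

lemma mem_downset_iff:
  fixes A :: "nat set"
  assumes "finite A" "\<And>i j. j \<in> A \<Longrightarrow> i \<le> j \<Longrightarrow> i \<in> A"
  shows "i \<in> A \<longleftrightarrow> i < card A"
proof (cases "A = {}")
  case False
  then have "A = {..Max A}"
    using assms(1) assms(2)[OF Max_in[OF assms(1) False]] by (auto intro: Max_ge)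
  then have "card A = Suc (Max A)" by (metis card_atMost)
  with \<open>A = {..Max A}\<close> show ?thesis by (metis atMost_iff less_Suc_eq_le)
qed simp

lemma finite_young_diagram_row: "finite {j. (i, j) \<in> young_diagram \<mu>}"
  by (rule finite_subset[OF _ finite_imageI[OF finite_young_diagram[of \<mu>], of snd]]) force

lemma mem_young_diagram_row:
  assumes "partition_of n \<mu>"
  shows "(i, j) \<in> young_diagram \<mu> \<longleftrightarrow> j < card {j. (i, j) \<in> young_diagram \<mu>}"
proof -
  have "(i, l) \<in> young_diagram \<mu>" if "(i, k) \<in> young_diagram \<mu>" "l \<le> k" for k l
    using young_diagram_downward[OF assms that(1)] that(2) by simp
  then have "j \<in> {j. (i, j) \<in> young_diagram \<mu>} \<longleftrightarrow> j < card {j. (i, j) \<in> young_diagram \<mu>}"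
    by (intro mem_downset_iff finite_young_diagram_row) blast
  then show ?thesis by simp
qed

lemma mem_young_diagram_column:
  assumes "partition_of n \<mu>"
  shows "(i, j) \<in> young_diagram \<mu> \<longleftrightarrow> i < card {i. (i, j) \<in> young_diagram \<mu>}"
proof -
  have "finite {i. (i, j) \<in> young_diagram \<mu>}"
    by (rule finite_subset[OF _ finite_imageI[OF finite_young_diagram[of \<mu>], of fst]]) force
  moreover have "(l, j) \<in> young_diagram \<mu>" if "(k, j) \<in> young_diagram \<mu>" "l \<le> k" for k l
    using young_diagram_downward[OF assms that(1)] that(2) by simp
  ultimately have "i \<in> {i. (i, j) \<in> young_diagram \<mu>} \<longleftrightarrow> i < card {i. (i, j) \<in> young_diagram \<mu>}"
    by (intro mem_downset_iff) blast+
  then show ?thesis by simp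
qed

lemma card_tableau_column:
  assumes t: "t \<in> tableaux \<mu>"
  shows "card {p\<in>{1..sum_list \<mu>}. snd (position \<mu> t p) = j} = card {i. (i, j) \<in> young_diagram \<mu>}"
proof (rule bij_betw_same_card[symmetric, where f = "\<lambda>i. t (i, j)"], rule bij_betwI[where g = "\<lambda>p. fst (position \<mu> t p)"])
  show "(\<lambda>i. t (i, j)) \<in> {i. (i, j) \<in> young_diagram \<mu>} \<rightarrow> {p\<in>{1..sum_list \<mu>}. snd (position \<mu> t p) = j}"
    using tableau_mem[OF t] t by (auto simp del: atLeastAtMost_iff)
  show "(\<lambda>p. fst (position \<mu> t p)) \<in> {p\<in>{1..sum_list \<mu>}. snd (position \<mu> t p) = j} \<rightarrow> {i. (i, j) \<in> young_diagram \<mu>}"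
  proof
    fix p assume "p \<in> {p\<in>{1..sum_list \<mu>}. snd (position \<mu> t p) = j}"
    then show "fst (position \<mu> t p) \<in> {i. (i, j) \<in> young_diagram \<mu>}"
      using tableau_position(2)[OF t, of p] by (cases "position \<mu> t p") simp
  qed
  show "fst (position \<mu> t (t (i, j))) = i" if "i \<in> {i. (i, j) \<in> young_diagram \<mu>}" for i
    using t that by simp
  show "t (fst (position \<mu> t p), j) = p" if "p \<in> {p\<in>{1..sum_list \<mu>}. snd (position \<mu> t p) = j}" for p
    using tableau_position(1)[OF t, of p] that by (cases "position \<mu> t p") simp
qed

lemma card_tabloid_of_row:
  assumes s: "s \<in> tabloid_of \<mu> w"
  shows "card {p\<in>{1..sum_list \<mu>}. w p = i} = card {j. (i, j) \<in> young_diagram \<mu>}"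
proof -
  have t: "s \<in> tableaux \<mu>" and rows: "\<And>x. x \<in> young_diagram \<mu> \<Longrightarrow> w (s x) = fst x"
    using s by (auto simp: tabloid_of_def)
  have "{p\<in>{1..sum_list \<mu>}. w p = i} = (\<lambda>j. s (i, j)) ` {j. (i, j) \<in> young_diagram \<mu>}"
  proof (intro equalityI subsetI)
    fix p assume p: "p \<in> {p\<in>{1..sum_list \<mu>}. w p = i}"
    then have "p \<in> {1..sum_list \<mu>}" by simp
    note pos = tableau_position[OF t this]
    have "fst (position \<mu> s p) = i" using rows[OF pos(2)] pos(1) p by simp
    with pos show "p \<in> (\<lambda>j. s (i, j)) ` {j. (i, j) \<in> young_diagram \<mu>}"
      by (metis (mono_tags, lifting) image_eqI mem_Collect_eq prod.collapse)
  qed (use tableau_mem[OF t] rows in \<open>auto simp del: atLeastAtMost_iff\<close>)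
  moreover have "inj_on (\<lambda>j. s (i, j)) {j. (i, j) \<in> young_diagram \<mu>}"
    using tableau_inj[OF t] by (auto intro!: inj_onI)
  ultimately show ?thesis by (simp add: card_image)
qed

text \<open>The rows are those of the removed and the added node. They differ because rows are
  initial segments: with equal row lengths the added node would already belong to the diagram of
  \<alpha>.\<close>

lemma one_box_shift_rows:
  assumes "partition_of n \<alpha>" "partition_of n \<beta>" "one_box_shift \<alpha> \<beta>"
  obtains a b where "a \<noteq> b"
    "\<And>i. card {j. (i, j) \<in> young_diagram \<beta>} + of_bool (i = a) = card {j. (i, j) \<in> young_diagram \<alpha>} + of_bool (i = b)"
proof -
  obtain x y where xy: "x \<in> young_diagram \<alpha>" "y \<notin> young_diagram \<alpha>"
      "young_diagram \<beta> = insert y (young_diagram \<alpha> - {x})"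
    using assms(3) unfolding one_box_shift_def by blast
  let ?row = "\<lambda>D i. {j :: nat. (i :: nat, j) \<in> D}"
  have rows: "card (?row (young_diagram \<beta>) i) + of_bool (i = fst x)
      = card (?row (young_diagram \<alpha>) i) + of_bool (i = fst y)" for i
  proof -
    let ?A = "?row (young_diagram \<alpha>) i"
    have fin: "finite ?A" by (rule finite_young_diagram_row)
    let ?A' = "if i = fst x then ?A - {snd x} else ?A"
    have "?row (young_diagram \<beta>) i = (if i = fst y then insert (snd y) ?A' else ?A')"
      unfolding xy(3) by (cases x; cases y) auto
    moreover have "snd y \<notin> ?A'" if "i = fst y"
      using xy(2) that by (cases y) auto
    moreover have "card ?A' + of_bool (i = fst x) = card ?A"
    proof (cases "i = fst x")
      case True
      then have "snd x \<in> ?A" using xy(1) by simp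
      from card_Suc_Diff1[OF fin this] True show ?thesis by simp
    qed simp
    moreover have "finite ?A'" using fin by (cases "i = fst x") simp_all
    ultimately show ?thesis by (cases "i = fst y") (simp_all only: if_True if_False card_insert_disjoint of_bool_eq, simp_all)
  qed
  have "fst x \<noteq> fst y"
  proof
    assume eq: "fst x = fst y"
    then have "card (?row (young_diagram \<beta>) (fst y)) = card (?row (young_diagram \<alpha>) (fst y))"
      using rows[of "fst y"] by simp
    moreover have "(fst y, snd y) \<in> young_diagram \<beta>" by (simp add: xy(3))
    ultimately have "(fst y, snd y) \<in> young_diagram \<alpha>"
      using mem_young_diagram_row[OF assms(1)] mem_young_diagram_row[OF assms(2)] by metis
    with xy(2) show False by simp
  qed
  with rows that show ?thesis by blast
qed

section \<open>Homomorphisms between Specht modules\<close>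

lemma specht_homD:
  assumes "h \<in> specht_hom n \<alpha> \<beta>"
  shows "v \<in> specht_module \<alpha> \<Longrightarrow> h v \<in> specht_module \<beta>"
    and "v \<in> specht_module \<alpha> \<Longrightarrow> w \<in> specht_module \<alpha> \<Longrightarrow> h (v + w) = h v + h w"
    and "v \<in> specht_module \<alpha> \<Longrightarrow> h (fun_scale c v) = fun_scale c (h v)"
    and "\<pi> permutes {1..n} \<Longrightarrow> v \<in> specht_module \<alpha> \<Longrightarrow> h (act \<pi> v) = act \<pi> (h v)"
    and "v \<notin> specht_module \<alpha> \<Longrightarrow> h v = 0"
  using assms unfolding specht_hom_def mem_Collect_eq by blast+

lemma specht_hom_zero:
  assumes "h \<in> specht_hom n \<alpha> \<beta>"
  shows "h 0 = 0"
proof -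
  have "0 \<in> specht_module \<alpha>" by (simp add: specht_module_def fun_space.span_zero)
  then have "h (fun_scale 0 0) = fun_scale 0 (h 0)"
    using assms by (intro specht_homD(3))
  then show ?thesis by (simp add: zero_fun_def)
qed

lemma specht_hom_sum:
  assumes h: "h \<in> specht_hom n \<alpha> \<beta>" and "\<And>i. i \<in> I \<Longrightarrow> f i \<in> specht_module \<alpha>"
  shows "h (\<Sum>i\<in>I. f i) = (\<Sum>i\<in>I. h (f i))"
  using assms(2)
proof (induction I rule: infinite_finite_induct)
  case (insert i I)
  then have "f i \<in> specht_module \<alpha>" "(\<Sum>i\<in>I. f i) \<in> specht_module \<alpha>"
    unfolding specht_module_def by (auto intro: fun_space.span_sum)
  then have "h (f i + (\<Sum>i\<in>I. f i)) = h (f i) + h (\<Sum>i\<in>I. f i)"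
    using h by (intro specht_homD(2))
  with insert show ?case
    unfolding sum.insert[OF insert.hyps] by (metis insertCI)
qed (simp_all only: specht_hom_zero[OF h] sum.infinite sum.empty not_False_eq_True)

lemma act_specht_module:
  assumes "\<pi> permutes {1..sum_list \<mu>}" "t \<in> tableaux \<mu>"
  shows "act \<pi> (polytabloid \<mu> t) \<in> specht_module \<mu>"
  unfolding act_polytabloid[OF assms] using assms by (intro polytabloid_mem comp_mem_tableaux)

text \<open>A single polytabloid generates the Specht module, since the symmetric group is
  transitive on the tableaux of a shape.\<close>

lemma specht_hom_eq_0:
  assumes h: "h \<in> specht_hom n \<alpha> \<beta>" and n: "sum_list \<alpha> = n"
    and t: "t \<in> tableaux \<alpha>" "h (polytabloid \<alpha> t) = 0"
  shows "h = 0"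
proof -
  \<comment> \<open>Membership is carried through the induction because \<open>h\<close> is known to
    be linear only on the Specht module.\<close>
  have "v \<in> specht_module \<alpha> \<and> h v = 0" if "v \<in> specht_module \<alpha>" for v
    using that unfolding specht_module_def[of \<alpha>]
  proof (induction rule: fun_space.span_induct_alt)
    case base
    show ?case by (intro conjI fun_space.span_zero specht_hom_zero[OF h])
  next
    case (step c x y)
    then obtain t' where t': "t' \<in> tableaux \<alpha>" "x = polytabloid \<alpha> t'" by blast
    obtain \<sigma> where \<sigma>: "\<sigma> permutes {1..n}" "t' = \<sigma> \<circ> t"
      using tableau_permutation[OF t(1) t'(1)] n by blast
    have "x = act \<sigma> (polytabloid \<alpha> t)"
      unfolding t' \<sigma>(2) using \<sigma>(1) n t(1) by (intro act_polytabloid[symmetric]) auto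
    then have "h x = act \<sigma> 0"
      using specht_homD(4)[OF h \<sigma>(1) polytabloid_mem[OF t(1)]] t(2) by simp
    then have "h x = 0" by (simp add: act_def zero_fun_def)
    have S: "x \<in> specht_module \<alpha>" "y \<in> specht_module \<alpha>"
      using polytabloid_mem[OF t'(1)] t'(2) step by (simp_all add: specht_module_def)
    then have cx: "fun_scale c x \<in> specht_module \<alpha>"
      unfolding specht_module_def by (intro fun_space.span_scale)
    have "h (fun_scale c x + y) = fun_scale c (h x) + h y"
      using specht_homD(2)[OF h cx S(2)] specht_homD(3)[OF h S(1)] by simp
    then have "h (fun_scale c x + y) = 0"
      using \<open>h x = 0\<close> step by (metis add.right_neutral fun_space.scale_zero_right)
    moreover have "fun_scale c x + y \<in> fun_space.span (polytabloid \<alpha> ` tableaux \<alpha>)"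
      using S(2) cx unfolding specht_module_def by (rule fun_space.span_add[rotated])
    ultimately show ?case by blast
  qed
  then have "h v = 0" for v
    using specht_homD(5)[OF h] by blast
  then show ?thesis by (simp add: fun_eq_iff)
qed

text \<open>This allows a tableau of shape \<alpha> to be fixed later without constructing
  one.\<close>

lemma specht_hom_no_tableaux:
  assumes "h \<in> specht_hom n \<alpha> \<beta>" "tableaux \<alpha> = {}"
  shows "h = 0"
proof -
  have "specht_module \<alpha> = ({0} :: 'a tabloid_vector set)" using assms(2) by (simp add: specht_module_def)
  then have "h v = 0" for v
    using specht_homD(5)[OF assms(1), of v] specht_hom_zero[OF assms(1)] by (cases "v = 0") simp_all
  then show ?thesis by (simp add: fun_eq_iff)
qed

text \<open>Alternation and the Garnir relation hold in the Specht module of \<alpha> and are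
  carried over by \<open>h\<close>; the kernel relation holds for every element of the Specht module
  of \<beta>.\<close>

lemma column_moves_specht_hom:
  fixes h :: "'a::field tabloid_vector \<Rightarrow> 'a tabloid_vector"
  assumes two: "(2 :: 'a) \<noteq> 0" and part: "partition_of n \<alpha>" "partition_of n \<beta>"
    and ab: "a \<noteq> b" "\<And>i. card {j. (i, j) \<in> young_diagram \<beta>} + of_bool (i = a)
        = card {j. (i, j) \<in> young_diagram \<alpha>} + of_bool (i = b)"
    and t: "t \<in> tableaux \<alpha>" and h: "h \<in> specht_hom n \<alpha> \<beta>"
  shows "column_moves {1..n} (\<lambda>p. snd (position \<alpha> t p)) a b
    (\<lambda>w. h (polytabloid \<alpha> t) (tabloid_of \<beta> w))"
proof -
  let ?P = "{1..n}" and ?col = "\<lambda>p. snd (position \<alpha> t p)"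
  let ?v = "h (polytabloid \<alpha> t)"
  let ?f = "\<lambda>w. ?v (tabloid_of \<beta> w)"
  have n: "sum_list \<alpha> = n" "sum_list \<beta> = n" using part by (simp_all add: partition_of_def)
  have column: "card {p\<in>?P. ?col p = y} = card {i. (i, y) \<in> young_diagram \<alpha>}" for y
    using card_tableau_column[OF t] n by simp
  interpret column_fillings ?P ?col a b
  proof
    show "card {p\<in>?P. ?col p = y'} \<le> card {p\<in>?P. ?col p = y}" if "y \<le> y'" for y y'
      unfolding column
    proof (rule card_mono)
      show "finite {i. (i, y) \<in> young_diagram \<alpha>}"
        by (rule finite_subset[OF _ finite_imageI[OF finite_young_diagram[of \<alpha>], of fst]]) force
      show "{i. (i, y') \<in> young_diagram \<alpha>} \<subseteq> {i. (i, y) \<in> young_diagram \<alpha>}"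
        using young_diagram_downward[OF part(1)] that by fastforce
    qed
  qed (use ab in auto)
  have v: "?v \<in> specht_module \<beta>"
    using specht_homD(1)[OF h] polytabloid_mem[OF t] by blast
  have stab: "\<pi> \<in> column_stabilizer \<alpha> t" if "\<pi> permutes ?P" "\<And>p. p \<in> ?P \<Longrightarrow> ?col (\<pi> p) = ?col p" for \<pi>
    using that n by (simp add: column_stabilizer_iff[OF t])
  have alternating: "?f (w \<circ> \<pi>) = of_int (sign \<pi>) * ?f w"
    if \<pi>: "\<pi> permutes ?P" "\<And>p. p \<in> ?P \<Longrightarrow> ?col (\<pi> p) = ?col p" for w \<pi>
  proof -
    have st: "\<pi> \<in> column_stabilizer \<alpha> t" using stab \<pi> by blast
    have "act \<pi> ?v = h (act \<pi> (polytabloid \<alpha> t))"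
      using specht_homD(4)[OF h \<pi>(1) polytabloid_mem[OF t]] by simp
    also have "\<dots> = fun_scale (of_int (sign \<pi>)) ?v"
      unfolding act_polytabloid_column[OF st t]
      by (rule specht_homD(3)[OF h polytabloid_mem[OF t]])
    finally have "act \<pi> ?v (tabloid_of \<beta> w) = of_int (sign \<pi>) * ?f w"
      by (simp add: fun_scale_def)
    then show ?thesis using act_tabloid_of[of \<pi> \<beta> ?v w] \<pi>(1) n by simp
  qed
  show ?thesis
  proof
    \<comment> \<open>A nonzero coefficient sits at an actual tabloid, which forces \<open>w\<close>
      to have the row lengths of \<beta>.\<close>
    fix w assume nz: "?f w \<noteq> 0"
    have "?v \<in> permutation_module \<beta>" using v specht_module_subset by blast
    then have "tabloid_of \<beta> w \<in> tabloid \<beta> ` tableaux \<beta>"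
      using nz by (rule permutation_module_support)
    then obtain s where s: "s \<in> tabloid_of \<beta> w" using self_mem_tabloid by blast
    then have "card {p\<in>?P. w p = i} = card {j. (i, j) \<in> young_diagram \<beta>}" for i
      using card_tabloid_of_row[OF s, of i] n by simp
    moreover have "{y. i < len y} = {j. (i, j) \<in> young_diagram \<alpha>}" for i
      unfolding len_def column using mem_young_diagram_column[OF part(1)] by blast
    moreover have "p = q" if pq: "p \<in> ?P" "q \<in> ?P" "?col p = ?col q" "w p = w q" for p q
    proof (rule ccontr)
      assume "p \<noteq> q"
      \<comment> \<open>Exchanging two equal values in a column leaves \<open>w\<close> alone but
        negates the coefficient.\<close>
      have "w \<circ> transpose p q = w" using pq(4) by (auto simp: fun_eq_iff transpose_def)
      moreover have "?f (w \<circ> transpose p q) = of_int (sign (transpose p q)) * ?f w"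
        using pq by (intro alternating permutes_swap_id) (auto simp: transpose_def)
      ultimately have "?f w = - ?f w" using \<open>p \<noteq> q\<close> by (simp add: sign_swap_id)
      then have "2 * ?f w = 0" by (simp add: eq_neg_iff_add_eq_0)
      with two nz show False by simp
    qed
    ultimately show "filling w"
      using ab(2) unfolding filling_def column_injective_def by simp
  next
    fix u y w assume u: "u \<in> ?P" "y < ?col u"
    let ?Z = "{z. z \<in> ?P \<and> ?col z = y}"
    have tr: "transpose z u permutes ?P" if "z \<in> ?Z" for z
      using that u by (intro permutes_swap_id) auto
    have "polytabloid \<alpha> t = (\<Sum>z\<in>?Z. act (transpose z u) (polytabloid \<alpha> t :: 'a tabloid_vector))"
      using act_polytabloid_garnir[OF two part(1) t, of u y] u n by simp
    then have "?v = h (\<Sum>z\<in>?Z. act (transpose z u) (polytabloid \<alpha> t))" by simp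
    also have "\<dots> = (\<Sum>z\<in>?Z. h (act (transpose z u) (polytabloid \<alpha> t)))"
      using tr n t by (intro specht_hom_sum[OF h] act_specht_module) auto
    also have "\<dots> = (\<Sum>z\<in>?Z. act (transpose z u) ?v)"
      using tr by (intro sum.cong refl specht_homD(4)[OF h _ polytabloid_mem[OF t]])
    finally have "?f w = (\<Sum>z\<in>?Z. act (transpose z u) ?v) (tabloid_of \<beta> w)"
      by (rule fun_cong)
    also have "\<dots> = (\<Sum>z\<in>?Z. ?f (w \<circ> transpose z u))"
      unfolding sum_apply using tr unfolding n(2)[symmetric] by (intro sum.cong refl act_tabloid_of)
    finally show "?f w = (\<Sum>z\<in>?Z. ?f (w \<circ> transpose z u))" .
  next
    fix p i and w :: "nat \<Rightarrow> nat" assume "p \<in> ?P" "i < w p"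
    then show "?f w = - (\<Sum>q | q \<in> ?P \<and> w q = i. ?f (w \<circ> transpose p q))"
      using specht_kernel[OF two part(2) v, of p i w] unfolding n(2) by blast
  next
    fix w w' :: "nat \<Rightarrow> nat" assume "\<And>p. p \<in> ?P \<Longrightarrow> w p = w' p"
    then show "?f w = ?f w'" using tabloid_of_cong[of \<beta> w w'] unfolding n(2) by metis
  qed (rule alternating)
qed

theorem theorem1p5:
  fixes n :: nat and \<alpha> \<beta> :: "nat list"
  assumes "CHAR('a::field) \<noteq> 2"
    and "partition_of n \<alpha>" and "partition_of n \<beta>"
    and "one_box_shift \<alpha> \<beta>"
  shows "map_space.dim
           (specht_hom n \<alpha> \<beta> :: ('a tabloid_vector \<Rightarrow> 'a tabloid_vector) set) \<le> 1"
proof -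
  let ?H = "specht_hom n \<alpha> \<beta> :: ('a tabloid_vector \<Rightarrow> 'a tabloid_vector) set"
  have two: "(2 :: 'a) \<noteq> 0"
  proof
    assume "(2 :: 'a) = 0"
    then have "CHAR('a) dvd 2" using of_nat_eq_0_iff_char_dvd[of 2, where 'a = 'a] by simp
    then have "CHAR('a) \<le> 2" "CHAR('a) \<noteq> 0" by (rule dvd_imp_le, simp) (metis \<open>CHAR('a) dvd 2\<close> dvd_0_left zero_neq_numeral)
    then have "CHAR('a) = 1" using assms(1) by linarith
    then show False by simp
  qed
  have n: "sum_list \<alpha> = n" using assms(2) by (simp add: partition_of_def)
  obtain a b where ab: "a \<noteq> b" "\<And>i. card {j. (i, j) \<in> young_diagram \<beta>} + of_bool (i = a)
      = card {j. (i, j) \<in> young_diagram \<alpha>} + of_bool (i = b)"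
    using one_box_shift_rows[OF assms(2-4)] by blast
  have "\<exists>h1. ?H \<subseteq> map_space.span {h1}"
  proof (cases "?H \<subseteq> {0}")
    case True
    then show ?thesis using map_space.span_zero by blast
  next
    case False
    then obtain h1 where h1: "h1 \<in> ?H" "h1 \<noteq> 0" by blast
    then obtain t where t: "t \<in> tableaux \<alpha>"
      using specht_hom_no_tableaux by blast
    let ?f = "\<lambda>(h :: 'a tabloid_vector \<Rightarrow> 'a tabloid_vector) w. h (polytabloid \<alpha> t) (tabloid_of \<beta> w)"
    note moves = column_moves_specht_hom[OF two assms(2,3) ab t]
    have nonzero: "\<exists>w. ?f h w \<noteq> 0" if h: "h \<in> ?H" "h \<noteq> 0" for h
    proof (rule ccontr)
      assume z: "\<nexists>w. ?f h w \<noteq> 0"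
      have "h (polytabloid \<alpha> t) \<in> permutation_module \<beta>"
        using specht_homD(1)[OF h(1) polytabloid_mem[OF t]] specht_module_subset by blast
      moreover have "(0 :: 'a tabloid_vector) \<in> permutation_module \<beta>"
        unfolding permutation_module_def by (rule fun_space.span_zero)
      ultimately have "h (polytabloid \<alpha> t) = 0"
        using z by (intro permutation_module_eqI) auto
      with specht_hom_eq_0[OF h(1) n t] h(2) show False by blast
    qed
    \<comment> \<open>Being canonical depends on \<open>t\<close>, \<open>a\<close> and
      \<open>b\<close> but not on a homomorphism, so this one \<open>w\<close> tests all of
      them.\<close>
    obtain w where w: "?f h1 w \<noteq> 0"
        and can: "column_fillings.canonical {1..n} (\<lambda>p. snd (position \<alpha> t p)) a b w"
      using column_moves.canonical_nonzero[OF moves[OF h1(1)]] nonzero[OF h1] by blast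
    have "h \<in> map_space.span {h1}" if h: "h \<in> ?H" for h
    proof -
      \<comment> \<open>The scalar cancels the coefficient at \<open>w\<close>; by
        \<open>canonical_nonzero_all\<close> a nonzero difference would have a nonzero coefficient
        there.\<close>
      define c where "c = ?f h w / ?f h1 w"
      define g where "g = h - map_scale c h1"
      have "g \<in> ?H"
        unfolding g_def using subspace_specht_hom h h1(1)
        by (intro map_space.subspace_diff map_space.subspace_scale)
      moreover have "?f g w = 0"
        using w by (simp add: g_def c_def map_scale_def fun_scale_def)
      ultimately have "g = 0"
        using column_moves.canonical_nonzero_all[OF moves _ can] nonzero by blast
      then have "h = map_scale c h1" by (simp add: g_def)
      then show ?thesis by (simp add: map_space.span_base map_space.span_scale)
    qed
    then show ?thesis by blast
  qed
  then obtain h1 where "?H \<subseteq> map_space.span {h1}" by blast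
  from map_space.dim_le_card[OF this] show ?thesis by simp
qed

end
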